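(* Let $d\ge3$ be an integer, $p_1,\dots,p_d\in(0,1)$, $J^d$ the first rencontre-time, and $\lambda_1,\lambda_2\in(0,1)$ arbitrary. Then, with the functions $UB$ and $LB$ defined in the context, $$E(J^d\mid J^d<\infty)\le\lim_{x\to1-}\frac{UB(x;\lambda_1\mid\varphi_d')}{LB(x;\lambda_2\mid\varphi_d)\left(1+LB(x;\lambda_2\mid\varphi_d)\right)},$$ $$E(J^d\mid J^d<\infty)\ge\lim_{x\to1-}\frac{LB(x;\lambda_2\mid\varphi_d')}{UB(x;\lambda_1\mid\varphi_d)\left(1+UB(x;\lambda_1\mid\varphi_d)\right)}.$$
   Context: Let $\{X^j_k\}_{k\ge1}$, $j=1,\dots,d$, be independent sequences, the $j$-th consisting of i.i.d. Bernoulli random variables with success parameter $p_j$ (all mutually independent); $S^j(n)=\sum_{i=1}^nX^j_i$; $J^d=\inf\{n\ge1:S^1(n)=\dots=S^d(n)\}$ ($\inf\emptyset=\infty$). Let $q_j=1-p_j$, $Q=\prod_jq_j$, $P=\prod_jp_jq_j^{-1}$, $T=Q(1+P^{1/d})^d$, and $r_n=Q^n\sum_{k=0}^n\binom nk^dP^k$ (the probability that $S^1(n)=\dots=S^d(n)$). With $[x]$ the greatest integer $\le x$, for $\alpha>0$, $\lambda\in(0,1)$ define $N(\alpha,\lambda)=\max\{[\alpha/\lambda]+1,[1/(\lambda\alpha)]+1\}$, $M(\alpha,\lambda)=\frac{\alpha+1}{\sqrt\alpha(1-\lambda)}$, $L(\alpha,\lambda)=\max\left\{\left[\left(\frac{(\alpha+1)+\sqrt{(\alpha+1)^2+4\lambda\alpha}}{2\lambda\alpha}\right)^2\right]+1,\left[\left(\frac{(\alpha+1)+\sqrt{(\alpha+1)^2+4\lambda\alpha}}{2\lambda}\right)^2\right]+1\right\}$,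 $C_1(\alpha,\lambda)=\max\left\{4,\frac{(\alpha+1)^2}{\alpha(1+\lambda\alpha)}\right\}\exp\!\left(-\frac12\frac{1+\lambda\alpha}{(1-\lambda)\alpha}\left((\alpha+1)^2+\frac{\lambda\alpha}{1+\lambda\alpha}\right)\right)$, $C_2(\alpha,\lambda)=\max\left\{4,\frac{(\alpha+1)^2}{\alpha+\lambda}\right\}\exp\!\left(-\frac12\frac{\alpha+\lambda}{(1-\lambda)\alpha^2}\left((\alpha+1)^2+\frac{\lambda\alpha^2}{\alpha+\lambda}\right)\right)$, $K(\alpha,d,\lambda)=\frac{(1-\lambda)\alpha+1}{\alpha+1}C_1^d+C_2^d$. Writing $N=N(P^{1/d},\lambda)$, $L=L(P^{1/d},\lambda)$, $M=M(P^{1/d},\lambda)$, $K=K(P^{1/d},d,\lambda)$, define for $0<x<1$: $UB(x;\lambda\mid\varphi_d)=\sum_{n=1}^{N-1}r_nx^n+\left(\frac{M}{\sqrt{2\pi}}\right)^{d-1}\sum_{n\ge N}n^{-\frac{d-1}{2}}(Tx)^n$; $LB(x;\lambda\mid\varphi_d)=\sum_{n=1}^{L-1}r_nx^n+\left(\frac{\sqrt{2\pi}}{e^2}\right)^dK\sum_{n\ge L}n^{-\frac{d-1}{2}}(Tx)^n$; $UB(x;\lambda\mid\varphi_d')=\sum_{n=1}^{N-1}nr_nx^{n-1}+\left(\frac{M}{\sqrt{2\pi}}\right)^{d-1}\sum_{n\ge N}n^{-\frac{d-3}{2}}x^{-1}(Tx)^n$; $LB(x;\lambda\mid\varphi_d')=\sum_{n=1}^{L-1}nr_nx^{n-1}+\left(\frac{\sqrt{2\pi}}{e^2}\right)^dK\sum_{n\ge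 L}n^{-\frac{d-3}{2}}x^{-1}(Tx)^n$. *)

theory Defs
  imports "HOL-Probability.Probability"
begin

text \<open>Sequences are indexed by j < d (the d sequences) and k \<ge> 1 (time).
  S j n = number of successes among X j 1, ..., X j n.\<close>

definition S_count :: "(nat \<Rightarrow> nat \<Rightarrow> 'a \<Rightarrow> bool) \<Rightarrow> nat \<Rightarrow> nat \<Rightarrow> 'a \<Rightarrow> nat" where
  "S_count X j n \<omega> = card {i \<in> {1..n}. X j i \<omega>}"

definition rencontre_time ::
  "nat \<Rightarrow> (nat \<Rightarrow> nat \<Rightarrow> 'a \<Rightarrow> bool) \<Rightarrow> 'a \<Rightarrow> enat" where
  "rencontre_time d X \<omega> =
     (if \<exists>n\<ge>1. \<forall>j<d. \<forall>j'<d. S_count X j n \<omega> = S_count X j' n \<omega>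
      then enat (LEAST n. n \<ge> 1 \<and> (\<forall>j<d. \<forall>j'<d. S_count X j n \<omega> = S_count X j' n \<omega>))
      else \<infinity>)"

definition cond_exp_finite :: "'a measure \<Rightarrow> ('a \<Rightarrow> enat) \<Rightarrow> ennreal" where
  "cond_exp_finite M J =
     (\<integral>\<^sup>+ \<omega>. (if J \<omega> < \<infinity> then ennreal (real (the_enat (J \<omega>))) else 0) \<partial>M)
     / emeasure M {\<omega> \<in> space M. J \<omega> < \<infinity>}"

definition QQ :: "nat \<Rightarrow> (nat \<Rightarrow> real) \<Rightarrow> real" where
  "QQ d p = (\<Prod>j<d. 1 - p j)"

definition PP :: "nat \<Rightarrow> (nat \<Rightarrow> real) \<Rightarrow> real" where
  "PP d p = (\<Prod>j<d. p j / (1 - p j))"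

definition TT :: "nat \<Rightarrow> (nat \<Rightarrow> real) \<Rightarrow> real" where
  "TT d p = QQ d p * (1 + PP d p powr (1 / real d)) ^ d"

definition rr :: "nat \<Rightarrow> (nat \<Rightarrow> real) \<Rightarrow> nat \<Rightarrow> real" where
  "rr d p n = QQ d p ^ n * (\<Sum>k\<le>n. real (n choose k) ^ d * PP d p ^ k)"

definition NN :: "real \<Rightarrow> real \<Rightarrow> nat" where
  "NN \<alpha> lam = max (nat \<lfloor>\<alpha> / lam\<rfloor> + 1) (nat \<lfloor>1 / (lam * \<alpha>)\<rfloor> + 1)"

definition MM :: "real \<Rightarrow> real \<Rightarrow> real" where
  "MM \<alpha> lam = (\<alpha> + 1) / (sqrt \<alpha> * (1 - lam))"

definition LL :: "real \<Rightarrow> real \<Rightarrow> nat" where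
  "LL \<alpha> lam =
     (let s = (\<alpha> + 1) + sqrt ((\<alpha> + 1)^2 + 4 * lam * \<alpha>)
      in max (nat \<lfloor>(s / (2 * lam * \<alpha>))^2\<rfloor> + 1) (nat \<lfloor>(s / (2 * lam))^2\<rfloor> + 1))"

definition C1 :: "real \<Rightarrow> real \<Rightarrow> real" where
  "C1 \<alpha> lam = max 4 ((\<alpha> + 1)^2 / (\<alpha> * (1 + lam * \<alpha>))) *
     exp (- (1/2) * ((1 + lam * \<alpha>) / ((1 - lam) * \<alpha>)) *
          ((\<alpha> + 1)^2 + lam * \<alpha> / (1 + lam * \<alpha>)))"

definition C2 :: "real \<Rightarrow> real \<Rightarrow> real" where
  "C2 \<alpha> lam = max 4 ((\<alpha> + 1)^2 / (\<alpha> + lam)) *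
     exp (- (1/2) * ((\<alpha> + lam) / ((1 - lam) * \<alpha>^2)) *
          ((\<alpha> + 1)^2 + lam * \<alpha>^2 / (\<alpha> + lam)))"

definition KK :: "real \<Rightarrow> nat \<Rightarrow> real \<Rightarrow> real" where
  "KK \<alpha> d lam = ((1 - lam) * \<alpha> + 1) / (\<alpha> + 1) * C1 \<alpha> lam ^ d + C2 \<alpha> lam ^ d"

definition UB :: "nat \<Rightarrow> (nat \<Rightarrow> real) \<Rightarrow> real \<Rightarrow> real \<Rightarrow> real" where
  "UB d p lam x =
     (let \<alpha> = PP d p powr (1 / real d); N = NN \<alpha> lam; M = MM \<alpha> lam; T = TT d p in
      (\<Sum>n\<in>{1..<N}. rr d p n * x ^ n) +
      (M / sqrt (2 * pi)) ^ (d - 1) *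
        (\<Sum>m. real (m + N) powr (- (real d - 1) / 2) * (T * x) ^ (m + N)))"

definition LB :: "nat \<Rightarrow> (nat \<Rightarrow> real) \<Rightarrow> real \<Rightarrow> real \<Rightarrow> real" where
  "LB d p lam x =
     (let \<alpha> = PP d p powr (1 / real d); L = LL \<alpha> lam; K = KK \<alpha> d lam; T = TT d p in
      (\<Sum>n\<in>{1..<L}. rr d p n * x ^ n) +
      (sqrt (2 * pi) / exp 2) ^ d * K *
        (\<Sum>m. real (m + L) powr (- (real d - 1) / 2) * (T * x) ^ (m + L)))"

definition UB' :: "nat \<Rightarrow> (nat \<Rightarrow> real) \<Rightarrow> real \<Rightarrow> real \<Rightarrow> real" where
  "UB' d p lam x =
     (let \<alpha> = PP d p powr (1 / real d); N = NN \<alpha> lam; M = MM \<alpha> lam; T = TT d p in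
      (\<Sum>n\<in>{1..<N}. real n * rr d p n * x ^ (n - 1)) +
      (M / sqrt (2 * pi)) ^ (d - 1) *
        (\<Sum>m. real (m + N) powr (- (real d - 3) / 2) * (T * x) ^ (m + N) / x))"

definition LB' :: "nat \<Rightarrow> (nat \<Rightarrow> real) \<Rightarrow> real \<Rightarrow> real \<Rightarrow> real" where
  "LB' d p lam x =
     (let \<alpha> = PP d p powr (1 / real d); L = LL \<alpha> lam; K = KK \<alpha> d lam; T = TT d p in
      (\<Sum>n\<in>{1..<L}. real n * rr d p n * x ^ (n - 1)) +
      (sqrt (2 * pi) / exp 2) ^ d * K *
        (\<Sum>m. real (m + L) powr (- (real d - 3) / 2) * (T * x) ^ (m + L) / x))"

end

theory Submission
  imports Defs "HOL-Real_Asymp.Real_Asymp"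
begin

text \<open>Let \<open>F\<close> and \<open>\<phi>\<close> be the generating functions of the first rencontre probabilities and of
  \<open>r\<^sub>n\<close>, \<open>n \<ge> 1\<close>. Renewal gives \<open>F (1 + \<phi>) = \<phi>\<close>, hence \<open>F' / F = \<phi>' / (\<phi> (1 + \<phi>))\<close> on \<open>(0, 1)\<close>,
  and this tends to \<open>E (J | J < \<infinity>)\<close> as \<open>x \<rightarrow> 1\<close>. It remains to bound the coefficients \<open>r\<^sub>n\<close>.
  With \<open>\<alpha> = P\<^bsup>1/d\<^esup>\<close> and \<open>b\<^sub>k\<close> the binomial weights of parameter \<open>\<alpha> / (1 + \<alpha>)\<close> one has
  \<open>r\<^sub>n = T\<^sup>n (\<Sum>k\<le>n. b\<^sub>k\<^sup>d)\<close>. From above, \<open>(\<Sum>k\<le>n. b\<^sub>k\<^sup>d) \<le> (max b\<^sub>k)\<^bsup>d-1\<^esup>\<close>, and Stirling's formula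
  bounds the mode. From below, Chebyshev's inequality puts mass 3/4 on \<open>O(\<surd>n)\<close> indices, and the power
  mean inequality yields the rate \<open>n\<^bsup>-(d-1)/2\<^esup>\<close>. The limits of the bounds exist because the bounding series
  have nonnegative coefficients; only when \<open>d = 3\<close> and \<open>T = 1\<close> does the denominator diverge, and then
  the quotient tends to infinity.\<close>

section \<open>Stirling's formula\<close>

text \<open>In both parts the difference of the two sides vanishes at 1 and has a nonnegative
  derivative, namely \<open>(y - 1)^2 / (y * (y + 1)^2)\<close> and
  \<open>(1 - 1 / y)^2 / 2\<close>.\<close>

lemma ln_bounds_ge_one:
  fixes x :: real
  assumes "x \<ge> 1"
  shows "2 * (x - 1) / (x + 1) \<le> ln x" and "ln x \<le> (x - 1 / x) / 2"
proof -
  have "ln 1 - 2 * (1 - 1) / (1 + 1) \<le> ln x - 2 * (x - 1) / (x + 1)"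
  proof (rule DERIV_nonneg_imp_nondecreasing[OF assms])
    fix y :: real assume "1 \<le> y" "y \<le> x"
    moreover have "(4::real) / (y + 1)\<^sup>2 \<le> 1 / y"
      using \<open>1 \<le> y\<close> sum_squares_ge_zero[of "y - 1" 0]
      by (simp add: field_simps power2_eq_square)
    ultimately show "\<exists>D. ((\<lambda>y. ln y - 2 * (y - 1) / (y + 1)) has_real_derivative D) (at y) \<and> 0 \<le> D"
      by (intro exI[of _ "1 / y - 4 / (y + 1)\<^sup>2"] conjI)
        ((rule derivative_eq_intros refl | force)+, auto simp: power2_eq_square field_simps)
  qed
  then show "2 * (x - 1) / (x + 1) \<le> ln x" by simp
  have "(1 - 1 / 1) / 2 - ln 1 \<le> (x - 1 / x) / 2 - ln x"
  proof (rule DERIV_nonneg_imp_nondecreasing[OF assms])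
    fix y :: real assume "1 \<le> y" "y \<le> x"
    moreover have "0 \<le> (1 - 1 / y)\<^sup>2 / 2" by simp
    ultimately show "\<exists>D. ((\<lambda>y. (y - 1 / y) / 2 - ln y) has_real_derivative D) (at y) \<and> 0 \<le> D"
      by (intro exI[of _ "(1 - 1 / y)\<^sup>2 / 2"])
        (rule conjI, (rule derivative_eq_intros refl | force)+, auto simp: power2_eq_square field_simps)
  qed
  then show "ln x \<le> (x - 1 / x) / 2" by simp
qed

text \<open>The factorial over Stirling's approximation without its constant; this sequence
  decreases to \<open>sqrt (2 * pi)\<close>. At \<open>n = 0\<close> division by zero gives 0, hence
  the assumption \<open>n \<ge> 1\<close> below.\<close>

definition stirling_ratio :: "nat \<Rightarrow> real" where
  "stirling_ratio n = fact n / (sqrt n * (n / exp 1) ^ n)"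

lemma stirling_ratio_pos: "n \<ge> 1 \<Longrightarrow> 0 < stirling_ratio n"
  by (simp add: stirling_ratio_def)

lemma ln_stirling_ratio:
  assumes "n \<ge> 1"
  shows "ln (stirling_ratio n) = ln (fact n) - (real n + 1 / 2) * ln (real n) + real n"
  using assms by (simp add: stirling_ratio_def ln_div ln_mult ln_realpow ln_sqrt algebra_simps)

text \<open>With \<open>x = 1 + 1 / n\<close> the difference is
  \<open>(n + 1 / 2) * ln x - 1\<close>. The lower bound for \<open>ln x\<close> makes the product
  exactly 1, the upper bound leaves a telescoping remainder.\<close>

lemma ln_stirling_ratio_step:
  assumes "n \<ge> 1"
  shows "0 \<le> ln (stirling_ratio n) - ln (stirling_ratio (Suc n))"
    and "ln (stirling_ratio n) - ln (stirling_ratio (Suc n)) \<le> (1 / n - 1 / Suc n) / 4"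
proof -
  define x where "x = 1 + 1 / real n"
  have n: "real n > 0" using assms by simp
  have x: "x \<ge> 1" using n by (simp add: x_def)
  have lnx: "ln x = ln (real n + 1) - ln (real n)"
    using n ln_div[of "real n + 1" "real n"] by (simp add: x_def add_divide_distrib add.commute)
  have eq: "ln (stirling_ratio n) - ln (stirling_ratio (Suc n)) = (real n + 1 / 2) * ln x - 1"
  proof -
    have "(fact (Suc n) :: real) = (real n + 1) * fact n" by (simp add: algebra_simps)
    then have "ln (fact (Suc n) :: real) = ln (real n + 1) + ln (fact n)"
      using n by (simp only: ln_mult) simp
    then show ?thesis
      using assms by (simp add: ln_stirling_ratio lnx algebra_simps del: fact_Suc)
  qed
  have "(real n + 1 / 2) * (2 * (x - 1) / (x + 1)) = 1"
    using n by (simp add: x_def divide_simps)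
  moreover have "(real n + 1 / 2) * (2 * (x - 1) / (x + 1)) \<le> (real n + 1 / 2) * ln x"
    using ln_bounds_ge_one(1)[OF x] n by (intro mult_left_mono) auto
  ultimately show "0 \<le> ln (stirling_ratio n) - ln (stirling_ratio (Suc n))"
    unfolding eq by linarith
  have "(real n + 1 / 2) * ln x \<le> (real n + 1 / 2) * ((x - 1 / x) / 2)"
    using ln_bounds_ge_one(2)[OF x] n by (intro mult_left_mono) auto
  also have "\<dots> = 1 + (1 / n - 1 / Suc n) / 4"
    using n by (simp add: x_def divide_simps) (simp add: algebra_simps)
  finally show "ln (stirling_ratio n) - ln (stirling_ratio (Suc n)) \<le> (1 / n - 1 / Suc n) / 4"
    unfolding eq by argo
qed

lemma stirling_ratio_decreasing:
  assumes "1 \<le> m" "m \<le> n"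
  shows "stirling_ratio n \<le> stirling_ratio m"
  using assms(2,1)
proof (induction rule: dec_induct)
  case (step k)
  then have "ln (stirling_ratio (Suc k)) \<le> ln (stirling_ratio k)"
    using ln_stirling_ratio_step(1)[of k] by simp
  then have "stirling_ratio (Suc k) \<le> stirling_ratio k"
    using step by (subst (asm) ln_le_cancel_iff) (auto intro: stirling_ratio_pos)
  with step show ?case by simp
qed simp

text \<open>Summing the telescoping bound from 1, where the ratio equals \<open>exp 1\<close>, loses
  at most 1/4 in the logarithm. This crude bound keeps the limit of the sequence away from
  0.\<close>

lemma stirling_ratio_ge_one:
  assumes "n \<ge> 1"
  shows "stirling_ratio n \<ge> 1"
proof -
  have "ln (stirling_ratio 1) - 1 / 4 \<le> ln (stirling_ratio n) - (1 / real n) * (1 / 4)"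
    using assms
  proof (induction rule: dec_induct)
    case (step k)
    then show ?case using ln_stirling_ratio_step(2)[of k] by (simp only:) argo
  qed simp
  moreover have "(1 / real n) * (1 / 4) \<ge> 0" by simp
  ultimately have "ln (stirling_ratio n) \<ge> ln (stirling_ratio 1) - 1 / 4" by linarith
  then have "ln (stirling_ratio n) \<ge> 0" by (simp add: ln_stirling_ratio)
  then show ?thesis using stirling_ratio_pos[OF assms] by (simp add: ln_ge_zero_iff)
qed

section \<open>Wallis' product and the constant in Stirling's formula\<close>

lemma wallis_product_eq:
  "(\<Prod>k=1..n. (4 * real k ^ 2) / (4 * real k ^ 2 - 1)) =
     2 ^ (4 * n) * fact n ^ 4 / (fact (2 * n) ^ 2 * (2 * real n + 1))"
proof (induction n)
  case (Suc n)
  have f: "(fact (2 * Suc n) :: real) = (2 * (real n + 1)) * (2 * real n + 1) * fact (2 * n)"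
    by (simp add: algebra_simps)
  have g: "(fact (Suc n) :: real) = (real n + 1) * fact n" by simp
  have h: "4 * real (Suc n) ^ 2 - 1 = (2 * real n + 1) * (2 * real n + 3)"
    by (simp add: power2_eq_square algebra_simps)
  have nz: "2 * real n + 1 \<noteq> 0" "2 * real n + 3 \<noteq> 0" "2 * real n + 2 \<noteq> 0" "real n + 1 \<noteq> 0" by linarith+
  have "(\<Prod>k=1..Suc n. (4 * real k ^ 2) / (4 * real k ^ 2 - 1)) =
      2 ^ (4 * n) * fact n ^ 4 / (fact (2 * n) ^ 2 * (2 * real n + 1)) *
      (4 * (real n + 1) ^ 2 / ((2 * real n + 1) * (2 * real n + 3)))"
    using Suc.IH h by (simp add: add.commute)
  also have "\<dots> = 2 ^ (4 * Suc n) * ((real n + 1) * fact n) ^ 4 /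
      (((2 * (real n + 1)) * (2 * real n + 1) * fact (2 * n)) ^ 2 * (2 * real n + 3))"
    using nz by (simp add: power_mult_distrib divide_simps) (simp add: eval_nat_numeral algebra_simps)
  also have "\<dots> = 2 ^ (4 * Suc n) * fact (Suc n) ^ 4 / (fact (2 * Suc n) ^ 2 * (2 * real (Suc n) + 1))"
    unfolding f g by (simp add: algebra_simps)
  finally show ?case .
qed simp

text \<open>The powers of \<open>n / exp 1\<close> cancel between \<open>n\<close> and
  \<open>2 * n\<close>, so the factorial form of Wallis' product becomes a relation between two
  Stirling ratios. In the limit it determines their common limit.\<close>

lemma stirling_ratio_wallis:
  assumes "n \<ge> 1"
  shows "stirling_ratio n ^ 4 = stirling_ratio (2 * n) ^ 2 *
    (2 * (\<Prod>k=1..n. (4 * real k ^ 2) / (4 * real k ^ 2 - 1)) * ((2 * real n + 1) / n))"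
proof -
  have n: "real n > 0" using assms by simp
  have s4: "sqrt (real n) ^ 4 = real n ^ 2"
    using n by (simp add: power4_eq_xxxx power2_eq_square)
  have e: "(2 * real n / exp 1) ^ (2 * n) = 2 ^ (2 * n) * (real n / exp 1) ^ (2 * n)"
    by (simp add: power_mult_distrib[symmetric])
  define y where "y = (real n / exp 1) ^ n"
  have y: "y > 0" "(real n / exp 1) ^ (2 * n) = y ^ 2"
    using n by (auto simp: y_def power_mult[symmetric] mult.commute)
  have t: "(2::real) ^ (4 * n) = (2 ^ (2 * n))\<^sup>2" by (simp add: power_mult[symmetric])
  have l: "stirling_ratio n = fact n / (sqrt n * y)" by (simp add: stirling_ratio_def y_def)
  have r: "stirling_ratio (2 * n) = fact (2 * n) / (sqrt (2 * n) * (2 ^ (2 * n) * y ^ 2))"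
    unfolding stirling_ratio_def y(2)[symmetric] e[symmetric] by simp
  have nz: "2 * real n + 1 \<noteq> 0" by linarith
  show ?thesis
    unfolding l r wallis_product_eq t using n y nz
    by (simp add: power_mult_distrib power_divide s4 divide_simps real_sqrt_mult)
       (simp add: eval_nat_numeral)
qed

text \<open>Wallis' formula forces the limit \<open>c\<close> to satisfy
  \<open>c ^ 4 = c ^ 2 * (2 * pi)\<close>, so \<open>c = sqrt (2 * pi)\<close>; a decreasing
  sequence stays above its limit.\<close>

lemma stirling_ratio_ge_sqrt_2pi:
  assumes "n \<ge> 1"
  shows "sqrt (2 * pi) \<le> stirling_ratio n"
proof -
  \<comment> \<open>The shift skips the value 0 at \<open>n = 0\<close>, which would spoil
    monotonicity.\<close>
  define w where "w = (\<lambda>n. stirling_ratio (Suc n))"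
  have dec: "decseq w"
    unfolding decseq_def w_def by (auto intro: stirling_ratio_decreasing)
  have "convergent w"
    using decseq_convergent[OF dec, of 1] stirling_ratio_ge_one unfolding convergent_def w_def by (metis One_nat_def Suc_le_mono zero_le)
  then obtain c where c: "w \<longlonglongrightarrow> c" by (auto simp: convergent_def)
  have le: "c \<le> w n" for n by (rule decseq_ge[OF dec c])
  have "c \<ge> 1"
    using c by (rule LIMSEQ_le_const) (auto simp: w_def intro!: stirling_ratio_ge_one)
  have c': "stirling_ratio \<longlonglongrightarrow> c" using c unfolding w_def by (rule LIMSEQ_imp_Suc)
  have lim4: "(\<lambda>n. stirling_ratio n ^ 4) \<longlonglongrightarrow> c ^ 4" by (intro tendsto_intros c')
  have "(\<lambda>n. stirling_ratio (2 * n)) \<longlonglongrightarrow> c"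
    using LIMSEQ_subseq_LIMSEQ[OF c', of "\<lambda>n. 2 * n"] by (simp add: strict_mono_def o_def)
  moreover have "(\<lambda>n. (2 * real n + 1) / n) \<longlonglongrightarrow> 2" by real_asymp
  ultimately have w: "(\<lambda>n. stirling_ratio (2 * n) ^ 2 *
      (2 * (\<Prod>k=1..n. (4 * real k ^ 2) / (4 * real k ^ 2 - 1)) * ((2 * real n + 1) / n)))
      \<longlonglongrightarrow> c ^ 2 * (2 * (pi / 2) * 2)"
    by (intro tendsto_intros wallis)
  have "\<forall>\<^sub>F n in sequentially. stirling_ratio n ^ 4 = stirling_ratio (2 * n) ^ 2 *
      (2 * (\<Prod>k=1..n. (4 * real k ^ 2) / (4 * real k ^ 2 - 1)) * ((2 * real n + 1) / n))"
    using eventually_ge_at_top[of 1] by eventually_elim (rule stirling_ratio_wallis)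
  then have "(\<lambda>n. stirling_ratio n ^ 4) \<longlonglongrightarrow> c ^ 2 * (2 * (pi / 2) * 2)"
    by (rule tendsto_cong[THEN iffD2]) (rule w)
  with lim4 have c4: "c ^ 4 = c ^ 2 * (2 * (pi / 2) * 2)" by (rule LIMSEQ_unique)
  have "c ^ 2 * c ^ 2 = c ^ 4" by (simp flip: power_add)
  also have "\<dots> = c ^ 2 * (2 * pi)" unfolding c4 by simp
  finally have "c ^ 2 = 2 * pi" using \<open>c \<ge> 1\<close> by (subst (asm) mult_left_cancel) auto
  then have "sqrt (2 * pi) = c" using \<open>c \<ge> 1\<close> by (metis real_sqrt_abs abs_of_nonneg order_trans zero_le_one)
  also have "c \<le> stirling_ratio n" using le[of "n - 1"] assms by (simp add: w_def)
  finally show ?thesis .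
qed

lemma fact_eq_stirling_ratio:
  "n \<ge> 1 \<Longrightarrow> fact n = stirling_ratio n * (sqrt n * (n / exp 1) ^ n)"
  by (simp add: stirling_ratio_def)

text \<open>The weight factors into a quotient of Stirling ratios, which is at most
  \<open>1 / sqrt (2 * pi)\<close>, an algebraic factor, and an entropy factor, which is at most
  1.\<close>

lemma Bernstein_le_stirling:
  fixes x :: real
  assumes k: "1 \<le> k" "k < n" and x: "0 < x" "x < 1"
  shows "Bernstein n k x \<le> sqrt (real n / (2 * pi * real k * (real n - real k)))"
proof -
  define l where "l = n - k"
  have l: "l \<ge> 1" "n = k + l" using k by (auto simp: l_def)
  have pos: "real k > 0" "real l > 0" "real n > 0" using k l by auto
  \<comment> \<open>\<open>A\<close> is the exponential of minus \<open>n\<close> times the relative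
    entropy of \<open>k / n\<close> with respect to \<open>x\<close>. Applying
    \<open>1 + y \<le> exp y\<close> to each base makes the exponents cancel.\<close>
  define A where "A = (n * x / k) ^ k * (n * (1 - x) / l) ^ l"
  have "A \<le> exp (n * x / k - 1) ^ k * exp (n * (1 - x) / l - 1) ^ l"
    unfolding A_def using pos x exp_ge_add_one_self[of "n * x / k - 1"] exp_ge_add_one_self[of "n * (1 - x) / l - 1"]
    by (intro mult_mono power_mono) auto
  also have "\<dots> = exp (k * (n * x / k - 1) + l * (n * (1 - x) / l - 1))"
    by (simp add: exp_of_nat_mult exp_add)
  also have "k * (n * x / k - 1) + l * (n * (1 - x) / l - 1) = 0"
    using pos by (simp add: field_simps l(2))
  finally have A: "A \<le> 1" by simp
  have A0: "A \<ge> 0" unfolding A_def using pos x by simp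
  have "Bernstein n k x = fact n / (fact k * fact l) * x ^ k * (1 - x) ^ l"
    using k by (simp add: Bernstein_def binomial_fact l_def)
  also have "\<dots> = stirling_ratio n / (stirling_ratio k * stirling_ratio l) * (sqrt n / (sqrt k * sqrt l)) * A"
    using pos k l(1) stirling_ratio_pos[of k] stirling_ratio_pos[of l]
    unfolding A_def
    by (simp add: fact_eq_stirling_ratio power_mult_distrib power_divide divide_simps)
       (simp add: l(2) power_add)
  also have "\<dots> \<le> 1 / sqrt (2 * pi) * (sqrt n / (sqrt k * sqrt l)) * 1"
  proof (intro mult_mono A A0)
    \<comment> \<open>Monotonicity compares \<open>n\<close> with \<open>k\<close>, and the ratio at
      \<open>l\<close> is at least the limit.\<close>
    have "stirling_ratio n * sqrt (2 * pi) \<le> stirling_ratio k * stirling_ratio l"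
      using l k stirling_ratio_pos[of k]
      by (intro mult_mono stirling_ratio_decreasing stirling_ratio_ge_sqrt_2pi) auto
    then show "stirling_ratio n / (stirling_ratio k * stirling_ratio l) \<le> 1 / sqrt (2 * pi)"
      using stirling_ratio_pos[of k] stirling_ratio_pos[of l] k l by (simp add: field_simps)
  qed (use pos in auto)
  also have "\<dots> = sqrt (real n / (2 * pi * real k * (real n - real k)))"
    using k by (simp add: real_sqrt_divide real_sqrt_mult l_def of_nat_diff)
  finally show ?thesis .
qed

section \<open>Power sums of binomial weights\<close>

text \<open>Two absorption identities for binomial coefficients give the ratio of consecutive
  weights, kept free of denominators; it serves to locate the mode.\<close>

lemma Bernstein_Suc_mult:
  fixes x :: real
  assumes "k < n"
  shows "Bernstein n (Suc k) x * ((real k + 1) * (1 - x)) = Bernstein n k x * ((real n - real k) * x)"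
proof -
  have "real (Suc k * (n choose Suc k)) = real ((n - k) * (n choose k))"
    by (simp only: binomial_absorption binomial_absorb_comp)
  then have c: "real (n choose Suc k) * (real k + 1) = (real n - real k) * real (n choose k)"
    using assms by (simp add: of_nat_diff algebra_simps)
  have e: "n - k = Suc (n - Suc k)" using assms by simp
  have "Bernstein n (Suc k) x * ((real k + 1) * (1 - x)) =
      (real (n choose Suc k) * (real k + 1)) * x ^ Suc k * (1 - x) ^ (n - k)"
    by (simp add: Bernstein_def e)
  also have "\<dots> = Bernstein n k x * ((real n - real k) * x)"
    unfolding c by (simp add: Bernstein_def)
  finally show ?thesis .
qed

text \<open>Comparing the largest weight with its two neighbours puts the mode within distance 1 of the
  mean, so that the mode and its complement lose at most a factor \<open>1 - lam\<close> against their means.\<close>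

lemma Bernstein_le_max:
  fixes x lam :: real
  assumes x: "0 < x" "x < 1" and lam: "lam < 1" and k: "k \<le> n"
    and large: "1 - x < lam * (n * x)" "x < lam * (n * (1 - x))"
  shows "Bernstein n k x \<le> 1 / ((1 - lam) * sqrt (2 * pi * n * (x * (1 - x))))"
proof -
  obtain m where m: "m \<le> n" "\<And>k. k \<le> n \<Longrightarrow> Bernstein n k x \<le> Bernstein n m x"
  proof -
    have "Max ((\<lambda>k. Bernstein n k x) ` {..n}) \<in> (\<lambda>k. Bernstein n k x) ` {..n}"
      by (intro Max_in) auto
    then show ?thesis
      using that Max_ge[of "(\<lambda>k. Bernstein n k x) ` {..n}"] by (smt (verit) atMost_iff finite_atMost finite_imageI imageE imageI)
  qed
  have bm: "Bernstein n m x > 0" using m x by (simp add: Bernstein_pos)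
  have lower: "real m \<ge> n * x - (1 - x)"
  \<comment> \<open>At \<open>m = n\<close> there is no right neighbour to compare with, but the
    bound is immediate.\<close>
  proof (cases "m = n")
    case True
    have "real n * x \<le> n" using x by (simp add: mult_left_le)
    with True x show ?thesis by simp
  next
    case False
    then have "m < n" using m by simp
    have "Bernstein n m x * ((real n - real m) * x) = Bernstein n (Suc m) x * ((real m + 1) * (1 - x))"
      using Bernstein_Suc_mult[OF \<open>m < n\<close>, of x] by simp
    also have "\<dots> \<le> Bernstein n m x * ((real m + 1) * (1 - x))"
      using m(2)[of "Suc m"] \<open>m < n\<close> x by (intro mult_right_mono) auto
    finally have "(real n - real m) * x \<le> (real m + 1) * (1 - x)" using bm by simp
    then show ?thesis by (simp add: algebra_simps)
  qed
  have upper: "real m \<le> n * x + x"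
  proof (cases m)
    case (Suc j)
    then have "j < n" using m by simp
    have "Bernstein n m x * ((real j + 1) * (1 - x)) = Bernstein n j x * ((real n - real j) * x)"
      using Bernstein_Suc_mult[OF \<open>j < n\<close>, of x] Suc by simp
    also have "\<dots> \<le> Bernstein n m x * ((real n - real j) * x)"
      using m(2)[of j] \<open>j < n\<close> x by (intro mult_right_mono) auto
    finally have "(real j + 1) * (1 - x) \<le> (real n - real j) * x" using bm by simp
    then show ?thesis using Suc by (simp add: algebra_simps)
  qed (use x in simp)
  have lo: "(1 - lam) * (n * x) \<le> m" and hi: "(1 - lam) * (n * (1 - x)) \<le> real n - real m"
    using lower upper large by (auto simp: algebra_simps)
  have n: "real n > 0"
    using large(1) x by (cases "n = 0") auto
  have p1: "(1 - lam) * (n * x) > 0" and p2: "(1 - lam) * (n * (1 - x)) > 0"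
    using n x lam by auto
  \<comment> \<open>The mode lies strictly between 0 and \<open>n\<close>, as the Stirling estimate
    requires.\<close>
  have mpos: "1 \<le> m" "m < n" using lo hi p1 p2 by (auto simp: Suc_le_eq intro: gr0I)
  have "((1 - lam) * (n * x)) * ((1 - lam) * (n * (1 - x))) \<le> real m * (real n - real m)"
    using lo hi p1 p2 by (intro mult_mono) auto
  then have Z: "n * n * (1 - lam)\<^sup>2 * (x * (1 - x)) \<le> real m * (real n - real m)"
    by (simp add: power2_eq_square algebra_simps)
  have "n / (2 * pi * m * (real n - real m)) = n / (2 * pi * (real m * (real n - real m)))" by simp
  also have "\<dots> \<le> n / (2 * pi * (n * n * (1 - lam)\<^sup>2 * (x * (1 - x))))"
    using Z n x lam mpos by (intro divide_left_mono mult_left_mono mult_pos_pos) auto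
  also have "\<dots> = 1 / ((1 - lam)\<^sup>2 * (2 * pi * n * (x * (1 - x))))" using n by simp
  finally have "n / (2 * pi * m * (real n - real m)) \<le> 1 / ((1 - lam)\<^sup>2 * (2 * pi * n * (x * (1 - x))))" .
  then have "sqrt (n / (2 * pi * m * (real n - real m))) \<le> sqrt (1 / ((1 - lam)\<^sup>2 * (2 * pi * n * (x * (1 - x)))))"
    by (rule real_sqrt_le_mono)
  also have "\<dots> = 1 / ((1 - lam) * sqrt (2 * pi * n * (x * (1 - x))))"
    using lam by (simp add: real_sqrt_divide real_sqrt_mult)
  finally have "Bernstein n m x \<le> 1 / ((1 - lam) * sqrt (2 * pi * n * (x * (1 - x))))"
    using Bernstein_le_stirling[OF mpos x] by simp
  with m(2)[OF k] show ?thesis by linarith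
qed

text \<open>In each power, \<open>d - 1\<close> factors are bounded by the largest weight; the
  remaining factors sum to 1.\<close>

lemma sum_Bernstein_power_le:
  fixes x lam :: real
  assumes x: "0 < x" "x < 1" and lam: "lam < 1" and d: "d \<ge> 1"
    and large: "1 - x < lam * (n * x)" "x < lam * (n * (1 - x))"
  shows "(\<Sum>k\<le>n. Bernstein n k x ^ d) \<le> (1 / ((1 - lam) * sqrt (2 * pi * n * (x * (1 - x))))) ^ (d - 1)"
    (is "_ \<le> ?c ^ _")
proof -
  have "(\<Sum>k\<le>n. Bernstein n k x ^ d) \<le> (\<Sum>k\<le>n. ?c ^ (d - 1) * Bernstein n k x)"
  proof (rule sum_mono)
    fix k assume "k \<in> {..n}"
    then have k: "k \<le> n" by simp
    have "Bernstein n k x ^ d = Bernstein n k x ^ (d - 1) * Bernstein n k x"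
      using d by (simp add: power_eq_if mult.commute)
    also have "\<dots> \<le> ?c ^ (d - 1) * Bernstein n k x"
      using Bernstein_le_max[OF x lam k large] x by (intro mult_right_mono power_mono Bernstein_nonneg) auto
    finally show "Bernstein n k x ^ d \<le> ?c ^ (d - 1) * Bernstein n k x" .
  qed
  also have "\<dots> = ?c ^ (d - 1)" by (simp flip: sum_distrib_left)
  finally show ?thesis .
qed

text \<open>The squared deviation is expanded through \<open>k * (k - 1)\<close> and
  \<open>k\<close>, whose weighted sums are known in closed form.\<close>

lemma Bernstein_variance:
  "(\<Sum>k\<le>n. (real k - n * x)\<^sup>2 * Bernstein n k x) = n * (x * (1 - x))"
proof -
  have "(\<Sum>k\<le>n. (real k - n * x)\<^sup>2 * Bernstein n k x) =
      (\<Sum>k\<le>n. real k * (real k - 1) * Bernstein n k x + (1 - 2 * (n * x)) * (real k * Bernstein n k x)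
        + (n * x)\<^sup>2 * Bernstein n k x)"
    by (rule sum.cong) (auto simp: power2_eq_square algebra_simps)
  also have "\<dots> = real n * (real n - 1) * x\<^sup>2 + (1 - 2 * (n * x)) * (n * x) + (n * x)\<^sup>2"
    by (simp add: sum.distrib flip: sum_distrib_left)
  also have "\<dots> = n * (x * (1 - x))" by (simp add: power2_eq_square algebra_simps)
  finally show ?thesis .
qed

text \<open>This is the power mean inequality: Jensen for the convex function \<open>x ^ d\<close>
  with equal weights \<open>1 / card W\<close>.\<close>

lemma sum_power_le_card_power_mult:
  fixes f :: "'b \<Rightarrow> real"
  assumes "finite W" "\<And>i. i \<in> W \<Longrightarrow> 0 \<le> f i" "d \<ge> 1"
  shows "(\<Sum>i\<in>W. f i) ^ d \<le> real (card W) ^ (d - 1) * (\<Sum>i\<in>W. f i ^ d)"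
proof (cases "W = {}")
  case False
  have conv: "convex_on {0::real..} (\<lambda>x. x ^ d)"
    using convex_power_even[of d] convex_power_odd[of d] by (cases "even d") (auto intro: convex_on_subset)
  have c: "real (card W) > 0" using False assms by (simp add: card_gt_0_iff)
  have "(\<Sum>i\<in>W. (1 / card W) *\<^sub>R f i) ^ d \<le> (\<Sum>i\<in>W. 1 / card W * f i ^ d)"
    using assms False c by (intro convex_on_sum[OF _ _ conv]) auto
  then have "(\<Sum>i\<in>W. f i) ^ d / real (card W) ^ d \<le> (\<Sum>i\<in>W. f i ^ d) / card W"
    by (simp add: power_divide flip: sum_divide_distrib)
  moreover have "real (card W) ^ d = real (card W) ^ (d - 1) * real (card W)"
    using assms by (simp add: power_eq_if mult.commute)
  ultimately show ?thesis using c by (simp add: field_simps)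
qed (use assms in \<open>simp add: power_0_left\<close>)

text \<open>The set fits between its minimum and its maximum, which are at most \<open>2 * r\<close>
  apart.\<close>

lemma card_nat_within_le:
  fixes c r :: real
  assumes "r \<ge> 0"
  shows "finite {k::nat. \<bar>real k - c\<bar> \<le> r}" "real (card {k::nat. \<bar>real k - c\<bar> \<le> r}) \<le> 2 * r + 1"
proof -
  let ?W = "{k::nat. \<bar>real k - c\<bar> \<le> r}"
  have "?W \<subseteq> {..nat \<lceil>c + r\<rceil>}"
  proof
    fix k assume "k \<in> ?W"
    then have "real k \<le> c + r" by (simp add: abs_le_iff)
    then show "k \<in> {..nat \<lceil>c + r\<rceil>}" by simp linarith
  qed
  then show fin: "finite ?W" using finite_subset by blast
  show "real (card ?W) \<le> 2 * r + 1"
  proof (cases "?W = {}")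
    case False
    have mem: "Min ?W \<in> ?W" "Max ?W \<in> ?W"
      using fin False by (auto intro!: Min_in Max_in simp del: mem_Collect_eq)
    have "card ?W \<le> card {Min ?W..Max ?W}"
      using fin by (intro card_mono) auto
    moreover have "Min ?W \<le> Max ?W" using mem fin by (meson Min_le)
    ultimately have "real (card ?W) \<le> real (Max ?W) - real (Min ?W) + 1" by simp
    with mem show ?thesis by (simp add: abs_le_iff)
  qed (use assms in simp)
qed

text \<open>By Chebyshev's inequality the indices within two standard deviations of the mean carry mass at
  least 3/4.\<close>

lemma sum_Bernstein_power_ge:
  fixes x :: real
  assumes x: "0 < x" "x < 1" and d: "d \<ge> 1" and large: "1 \<le> n * (x * (1 - x))"
  shows "(3 / 4) ^ d / (5 * sqrt (n * (x * (1 - x)))) ^ (d - 1) \<le> (\<Sum>k\<le>n. Bernstein n k x ^ d)"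
proof -
  define \<sigma> where "\<sigma> = sqrt (n * (x * (1 - x)))"
  define W where "W = {k. \<bar>real k - n * x\<bar> \<le> 2 * \<sigma>}"
  have s: "\<sigma> \<ge> 1" "\<sigma>\<^sup>2 = n * (x * (1 - x))" using large by (auto simp: \<sigma>_def)
  have B: "Bernstein n k x \<ge> 0" for k using x by (simp add: Bernstein_nonneg)
  have finW: "finite W" and "real (card W) \<le> 2 * (2 * \<sigma>) + 1"
    unfolding W_def using card_nat_within_le[of "2 * \<sigma>"] s by auto
  \<comment> \<open>The variance is at least 1, so
    \<open>4 * \<sigma> + 1 \<le> 5 * \<sigma>\<close>; this is the origin of the factor 5.\<close>
  then have cW: "real (card (W \<inter> {..n})) \<le> 5 * \<sigma>"
    using s(1) card_mono[OF finW, of "W \<inter> {..n}"] by simp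
  have "(\<Sum>k\<in>{..n} - W. Bernstein n k x) * (4 * \<sigma>\<^sup>2) \<le> (\<Sum>k\<in>{..n} - W. (real k - n * x)\<^sup>2 * Bernstein n k x)"
    unfolding sum_distrib_right
  proof (rule sum_mono)
    fix k assume "k \<in> {..n} - W"
    then have "2 * \<sigma> \<le> \<bar>real k - n * x\<bar>" by (simp add: W_def)
    then have "(2 * \<sigma>)\<^sup>2 \<le> \<bar>real k - n * x\<bar>\<^sup>2" using s by (intro power_mono) auto
    then show "Bernstein n k x * (4 * \<sigma>\<^sup>2) \<le> (real k - n * x)\<^sup>2 * Bernstein n k x"
      using B[of k] by (simp add: mult.commute mult_left_mono)
  qed
  also have "\<dots> \<le> (\<Sum>k\<le>n. (real k - n * x)\<^sup>2 * Bernstein n k x)"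
    using B by (intro sum_mono2) auto
  also have "\<dots> = \<sigma>\<^sup>2" by (simp add: Bernstein_variance s)
  finally have "(\<Sum>k\<in>{..n} - W. Bernstein n k x) \<le> 1 / 4" using s(1) by simp
  moreover have "(\<Sum>k\<in>{..n} - W. Bernstein n k x) + (\<Sum>k\<in>W \<inter> {..n}. Bernstein n k x) = 1"
    using sum.Int_Diff[of "{..n}" "\<lambda>k. Bernstein n k x" W] by (simp add: Int_commute)
  ultimately have "3 / 4 \<le> (\<Sum>k\<in>W \<inter> {..n}. Bernstein n k x)" by simp
  then have "(3 / 4) ^ d \<le> (\<Sum>k\<in>W \<inter> {..n}. Bernstein n k x) ^ d" by (intro power_mono) auto
  also have "\<dots> \<le> real (card (W \<inter> {..n})) ^ (d - 1) * (\<Sum>k\<in>W \<inter> {..n}. Bernstein n k x ^ d)"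
    using B d by (intro sum_power_le_card_power_mult) auto
  also have "\<dots> \<le> (5 * \<sigma>) ^ (d - 1) * (\<Sum>k\<le>n. Bernstein n k x ^ d)"
    using cW B by (intro mult_mono power_mono sum_mono2 sum_nonneg) auto
  finally show ?thesis using s(1) unfolding \<sigma>_def[symmetric] by (simp add: field_simps)
qed

section \<open>Coefficient bounds\<close>

lemma mult_exp_neg_le:
  fixes y :: real
  shows "y * exp (- y) \<le> exp (- 1)"
proof -
  have "y \<le> exp (y - 1)" using exp_ge_add_one_self[of "y - 1"] by simp
  then have "y * exp (- y) \<le> exp (y - 1) * exp (- y)" by (intro mult_right_mono) auto
  then show ?thesis by (simp flip: exp_add)
qed

text \<open>The constants \<open>C1\<close> and \<open>C2\<close> have this form with \<open>s = (\<alpha> + 1)\<^sup>2 / \<alpha>\<close>; the bound loses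
  a lot, but it is all that the comparison with Chebyshev's inequality needs.\<close>

lemma max_mult_exp_le:
  fixes s u v :: real
  assumes "4 \<le> s" "u \<le> s" "s / 2 \<le> v"
  shows "max 4 u * exp (- v) \<le> 2 * exp (- 1)"
proof -
  have "max 4 u * exp (- v) \<le> s * exp (- (s / 2))" using assms by (intro mult_mono) auto
  also have "\<dots> \<le> 2 * exp (- 1)" using mult_exp_neg_le[of "s / 2"] by simp
  finally show ?thesis .
qed

lemma square_succ_div_ge_four:
  fixes \<alpha> :: real
  assumes "\<alpha> > 0"
  shows "4 \<le> (\<alpha> + 1)\<^sup>2 / \<alpha>"
  using assms sum_squares_ge_zero[of "\<alpha> - 1" 0] by (simp add: field_simps power2_eq_square)

lemma C1_bounds:
  assumes a: "\<alpha> > 0" and l: "0 < lam" "lam < 1"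
  shows "0 < C1 \<alpha> lam" "C1 \<alpha> lam \<le> 2 * exp (- 1)"
proof -
  show "0 < C1 \<alpha> lam" by (simp add: C1_def less_max_iff_disj)
  define v where "v = 1/2 * ((1 + lam * \<alpha>) / ((1 - lam) * \<alpha>)) * ((\<alpha> + 1)\<^sup>2 + lam * \<alpha> / (1 + lam * \<alpha>))"
  have "(\<alpha> + 1)\<^sup>2 / (\<alpha> * (1 + lam * \<alpha>)) \<le> (\<alpha> + 1)\<^sup>2 / \<alpha>"
    using a l by (intro divide_left_mono mult_pos_pos add_pos_pos) (auto simp: mult_le_cancel_left1)
  \<comment> \<open>Dropping the nonnegative \<open>lam\<close> terms and replacing
    \<open>1 - lam\<close> by 1 in the denominator only decreases \<open>v\<close>.\<close>
  moreover have "(\<alpha> + 1)\<^sup>2 / \<alpha> / 2 \<le> v"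
  proof -
    define w where "w = (1 + lam * \<alpha>) / ((1 - lam) * \<alpha>) * ((\<alpha> + 1)\<^sup>2 + lam * \<alpha> / (1 + lam * \<alpha>))"
    have "1 / \<alpha> \<le> (1 + lam * \<alpha>) / ((1 - lam) * \<alpha>)"
      using a l by (intro frac_le) auto
    then have "1 / \<alpha> * (\<alpha> + 1)\<^sup>2 \<le> w"
      unfolding w_def using a l by (intro mult_mono) auto
    moreover have "v = w / 2" by (simp add: v_def w_def)
    ultimately show ?thesis by simp
  qed
  ultimately have "max 4 ((\<alpha> + 1)\<^sup>2 / (\<alpha> * (1 + lam * \<alpha>))) * exp (- v) \<le> 2 * exp (- 1)"
    by (intro max_mult_exp_le[OF square_succ_div_ge_four[OF a]])
  then show "C1 \<alpha> lam \<le> 2 * exp (- 1)" by (simp add: C1_def v_def)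
qed

lemma C2_bounds:
  assumes a: "\<alpha> > 0" and l: "0 < lam" "lam < 1"
  shows "0 < C2 \<alpha> lam" "C2 \<alpha> lam \<le> 2 * exp (- 1)"
proof -
  show "0 < C2 \<alpha> lam" by (simp add: C2_def less_max_iff_disj)
  define v where "v = 1/2 * ((\<alpha> + lam) / ((1 - lam) * \<alpha>\<^sup>2)) * ((\<alpha> + 1)\<^sup>2 + lam * \<alpha>\<^sup>2 / (\<alpha> + lam))"
  have "(\<alpha> + 1)\<^sup>2 / (\<alpha> + lam) \<le> (\<alpha> + 1)\<^sup>2 / \<alpha>"
    using a l by (intro divide_left_mono) auto
  moreover have "(\<alpha> + 1)\<^sup>2 / \<alpha> / 2 \<le> v"
  proof -
    define w where "w = (\<alpha> + lam) / ((1 - lam) * \<alpha>\<^sup>2) * ((\<alpha> + 1)\<^sup>2 + lam * \<alpha>\<^sup>2 / (\<alpha> + lam))"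
    have "\<alpha> / \<alpha>\<^sup>2 \<le> (\<alpha> + lam) / ((1 - lam) * \<alpha>\<^sup>2)"
      using a l by (intro frac_le) auto
    then have "\<alpha> / \<alpha>\<^sup>2 * (\<alpha> + 1)\<^sup>2 \<le> w"
      unfolding w_def using a l by (intro mult_mono) auto
    moreover have "\<alpha> / \<alpha>\<^sup>2 = 1 / \<alpha>" using a by (simp add: power2_eq_square)
    moreover have "v = w / 2" by (simp add: v_def w_def)
    ultimately show ?thesis by simp
  qed
  ultimately have "max 4 ((\<alpha> + 1)\<^sup>2 / (\<alpha> + lam)) * exp (- v) \<le> 2 * exp (- 1)"
    by (intro max_mult_exp_le[OF square_succ_div_ge_four[OF a]])
  then show "C2 \<alpha> lam \<le> 2 * exp (- 1)" by (simp add: C2_def v_def)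
qed

text \<open>The weight in front of \<open>C1 \<alpha> lam ^ d\<close> is at most 1, so both summands
  obey the same bound.\<close>

lemma KK_bounds:
  assumes a: "\<alpha> > 0" and l: "0 < lam" "lam < 1"
  shows "0 < KK \<alpha> d lam" "KK \<alpha> d lam \<le> 2 * (2 * exp (- 1)) ^ d"
proof -
  have pos: "(1 - lam) * \<alpha> + 1 > 0" using a l by (simp add: add_pos_pos)
  show "0 < KK \<alpha> d lam"
    unfolding KK_def using a
    by (intro add_pos_pos mult_pos_pos divide_pos_pos zero_less_power C1_bounds C2_bounds pos a l) simp
  have "KK \<alpha> d lam \<le> 1 * (2 * exp (- 1)) ^ d + (2 * exp (- 1)) ^ d"
    unfolding KK_def
  proof (intro add_mono mult_mono power_mono)
    show "((1 - lam) * \<alpha> + 1) / (\<alpha> + 1) \<le> 1" using a l by (simp add: algebra_simps)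
  qed (use C1_bounds[OF a l] C2_bounds[OF a l] pos a in auto)
  then show "KK \<alpha> d lam \<le> 2 * (2 * exp (- 1)) ^ d" by simp
qed

text \<open>This is the factor that each dimension contributes to the lower constant. The target
  3/10 is 3/4 divided by 5/2: Chebyshev's mass 3/4 over a window of width five standard deviations,
  each at most \<open>sqrt n / 2\<close>.\<close>

lemma sqrt_2pi_constant_le: "sqrt (2 * pi) / exp 2 * (2 * exp (- 1)) \<le> 3 / 10"
proof -
  have "sqrt (2 * pi) \<le> sqrt (2 * 3.15)"
    using pi_approx by (intro real_sqrt_le_mono) simp
  also have "\<dots> \<le> 2.52" by (intro real_le_lsqrt) (auto simp: power2_eq_square)
  finally have s: "sqrt (2 * pi) \<le> 2.52" .
  \<comment> \<open>The sixth power of the quadratic Taylor bound at 1/2 is precise enough for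
    \<open>exp 3 \<ge> 17\<close>.\<close>
  have "(1 + 1 / 2 + (1 / 2)\<^sup>2 / 2 :: real) ^ 6 \<le> exp (1 / 2) ^ 6"
    using exp_lower_Taylor_quadratic[of "1 / 2 :: real"] by (intro power_mono) auto
  also have "exp (1 / 2 :: real) ^ 6 = exp 3" by (simp flip: exp_of_nat_mult)
  finally have e: "(17::real) \<le> exp 3" by (simp add: eval_nat_numeral)
  have "sqrt (2 * pi) / exp 2 * (2 * exp (- 1)) = 2 * sqrt (2 * pi) / exp 3"
    by (simp add: exp_minus divide_simps flip: exp_add)
  also have "\<dots> \<le> 2 * 2.52 / 17" using s e by (intro frac_le) auto
  finally show ?thesis by simp
qed

lemma powr_neg_half_diff:
  assumes "n \<ge> 1" "d \<ge> 1"
  shows "real n powr (- (real d - 1) / 2) = 1 / sqrt n ^ (d - 1)"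
proof -
  have e: "- (real d - 1) / 2 = - (1 / 2 * real (d - 1))"
    using assms by (simp add: of_nat_diff field_simps)
  have "sqrt n ^ (d - 1) = (real n powr (1 / 2)) powr real (d - 1)"
    using assms by (subst powr_realpow) (simp_all add: powr_half_sqrt)
  then show ?thesis unfolding e powr_minus_divide by (simp only: powr_powr)
qed

text \<open>All that is kept of the threshold is that the variance
  \<open>n * \<alpha> / (\<alpha> + 1)^2\<close> is at least 1. The first entry of the maximum
  serves \<open>\<alpha> \<le> 1\<close>, the second \<open>\<alpha> > 1\<close>.\<close>

lemma LL_le_imp_ge:
  assumes a: "\<alpha> > 0" and l: "0 < lam" "lam < 1" and n: "LL \<alpha> lam \<le> n"
  shows "(\<alpha> + 1)\<^sup>2 / \<alpha> \<le> n"
proof -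
  define s where "s = (\<alpha> + 1) + sqrt ((\<alpha> + 1)^2 + 4 * lam * \<alpha>)"
  have "sqrt ((\<alpha> + 1)^2) \<le> sqrt ((\<alpha> + 1)^2 + 4 * lam * \<alpha>)"
    using a l by (intro real_sqrt_le_mono) auto
  then have s: "2 * (\<alpha> + 1) \<le> s" using a by (simp add: s_def)
  have floor: "y \<le> real n" if "nat \<lfloor>y\<rfloor> + 1 \<le> n" for y :: real
    using that by linarith
  have n1: "(s / (2 * lam * \<alpha>))\<^sup>2 \<le> n" and n2: "(s / (2 * lam))\<^sup>2 \<le> n"
    using n floor unfolding LL_def Let_def s_def[symmetric] by auto
  show ?thesis
  proof (cases "\<alpha> \<le> 1")
    case True
    have "(\<alpha> + 1) / \<alpha> \<le> s / (2 * lam * \<alpha>)"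
    proof -
      have "(\<alpha> + 1) / \<alpha> \<le> (s / 2) / (lam * \<alpha>)" using s a l by (intro frac_le) auto
      then show ?thesis by simp
    qed
    then have "((\<alpha> + 1) / \<alpha>)\<^sup>2 \<le> (s / (2 * lam * \<alpha>))\<^sup>2" using a by (intro power_mono) auto
    moreover have "(\<alpha> + 1)\<^sup>2 / \<alpha> \<le> (\<alpha> + 1)\<^sup>2 / \<alpha>\<^sup>2"
      using a True by (intro divide_left_mono) (auto simp: power2_eq_square mult_left_le)
    ultimately show ?thesis using n1 by (simp add: power_divide)
  next
    case False
    have "2 * (\<alpha> + 1) / 2 \<le> s / (2 * lam)" using s a l by (intro frac_le) auto
    then have "(\<alpha> + 1)\<^sup>2 \<le> (s / (2 * lam))\<^sup>2" using a by (intro power_mono) auto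
    moreover have "(\<alpha> + 1)\<^sup>2 / \<alpha> \<le> (\<alpha> + 1)\<^sup>2 / 1"
      using a False by (intro divide_left_mono) auto
    ultimately show ?thesis using n2 by simp
  qed
qed

text \<open>The floor plus 1 makes the inequalities strict. They are the two hypotheses of the mode
  estimate at \<open>x = \<alpha> / (1 + \<alpha>)\<close>, multiplied by
  \<open>1 + \<alpha>\<close>.\<close>

lemma NN_le_imp_gt:
  assumes a: "\<alpha> > 0" and l: "0 < lam" and n: "NN \<alpha> lam \<le> n"
  shows "\<alpha> < lam * n" "1 < lam * (n * \<alpha>)"
proof -
  have floor: "y < real n" if "nat \<lfloor>y\<rfloor> + 1 \<le> n" for y :: real
    using that by linarith
  have "\<alpha> / lam < n" "1 / (lam * \<alpha>) < n"
    using n floor unfolding NN_def by auto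
  then show "\<alpha> < lam * n" "1 < lam * (n * \<alpha>)"
    using a l by (auto simp: field_simps)
qed

section \<open>Two-sided bounds for the agreement probabilities\<close>

text \<open>Since \<open>\<alpha> ^ d\<close> equals \<open>PP d p\<close>, each summand of
  \<open>rr\<close> is the \<open>d\<close>-th power of \<open>(n choose k) * \<alpha> ^ k\<close>.
  Dividing that base by \<open>(1 + \<alpha>) ^ n\<close> gives a binomial weight, and the
  normalising factors collect in \<open>TT\<close>.\<close>

lemma rr_eq_sum_Bernstein:
  assumes P: "PP d p > 0" and d: "d \<ge> 1"
  defines "\<alpha> \<equiv> PP d p powr (1 / real d)"
  shows "rr d p n = TT d p ^ n * (\<Sum>k\<le>n. Bernstein n k (\<alpha> / (1 + \<alpha>)) ^ d)"
proof -
  have a: "\<alpha> > 0" using P by (simp add: \<alpha>_def)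
  have ad: "\<alpha> ^ d = PP d p"
    unfolding \<alpha>_def using P d by (simp add: powr_realpow[symmetric] powr_powr)
  have "(1 + \<alpha>) ^ (d * n) * Bernstein n k (\<alpha> / (1 + \<alpha>)) ^ d = real (n choose k) ^ d * PP d p ^ k"
    if "k \<le> n" for k
  proof -
    have c: "1 - \<alpha> / (1 + \<alpha>) = 1 / (1 + \<alpha>)" using a by (simp add: field_simps)
    have "Bernstein n k (\<alpha> / (1 + \<alpha>)) = real (n choose k) * \<alpha> ^ k / (1 + \<alpha>) ^ (k + (n - k))"
      unfolding Bernstein_def c by (simp add: power_divide power_add)
    then have "Bernstein n k (\<alpha> / (1 + \<alpha>)) ^ d = real (n choose k) ^ d * (\<alpha> ^ d) ^ k / (1 + \<alpha>) ^ (d * n)"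
      using that by (simp add: power_divide power_mult_distrib power_mult[symmetric] mult.commute)
    then show ?thesis using a ad by simp
  qed
  then have "(\<Sum>k\<le>n. real (n choose k) ^ d * PP d p ^ k) =
      (1 + \<alpha>) ^ (d * n) * (\<Sum>k\<le>n. Bernstein n k (\<alpha> / (1 + \<alpha>)) ^ d)"
    unfolding sum_distrib_left by (intro sum.cong) auto
  then show ?thesis
    by (simp add: rr_def TT_def \<alpha>_def[symmetric] power_mult_distrib power_mult)
qed

lemma rr_le:
  assumes P: "PP d p > 0" and T: "TT d p \<ge> 0" and d: "d \<ge> 1" and l: "0 < lam" "lam < 1"
  defines "\<alpha> \<equiv> PP d p powr (1 / real d)"
  assumes n: "NN \<alpha> lam \<le> n"
  shows "rr d p n \<le> (MM \<alpha> lam / sqrt (2 * pi)) ^ (d - 1) * (real n powr (- (real d - 1) / 2) * TT d p ^ n)"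
proof -
  have a: "\<alpha> > 0" using P by (simp add: \<alpha>_def)
  define x where "x = \<alpha> / (1 + \<alpha>)"
  have x: "0 < x" "x < 1" "1 - x = 1 / (1 + \<alpha>)" using a by (auto simp: x_def field_simps)
  have v: "x * (1 - x) = \<alpha> / (\<alpha> + 1)\<^sup>2" unfolding x(3) by (simp add: x_def power2_eq_square add.commute)
  have "n \<ge> 1" using n by (simp add: NN_def)
  have "1 - x < lam * (n * x)" "x < lam * (n * (1 - x))"
    using divide_strict_right_mono[OF NN_le_imp_gt(2)[OF a l(1) n], of "1 + \<alpha>"]
      divide_strict_right_mono[OF NN_le_imp_gt(1)[OF a l(1) n], of "1 + \<alpha>"] a
    unfolding x(3) by (simp_all add: x_def)
  then have "(\<Sum>k\<le>n. Bernstein n k x ^ d) \<le> (1 / ((1 - lam) * sqrt (2 * pi * n * (x * (1 - x))))) ^ (d - 1)"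
    using x l d by (intro sum_Bernstein_power_le) auto
  \<comment> \<open>Here \<open>x * (1 - x) = \<alpha> / (\<alpha> + 1)^2\<close> turns the bound at
    the mode into the constant \<open>MM\<close>.\<close>
  also have "1 / ((1 - lam) * sqrt (2 * pi * n * (x * (1 - x)))) = MM \<alpha> lam / sqrt (2 * pi) * (1 / sqrt n)"
    using a l \<open>n \<ge> 1\<close> unfolding v by (simp add: MM_def real_sqrt_mult real_sqrt_divide)
  finally have "(\<Sum>k\<le>n. Bernstein n k x ^ d) \<le>
      (MM \<alpha> lam / sqrt (2 * pi)) ^ (d - 1) * real n powr (- (real d - 1) / 2)"
    unfolding powr_neg_half_diff[OF \<open>n \<ge> 1\<close> d] by (simp add: power_mult_distrib power_divide)
  from mult_left_mono[OF this, of "TT d p ^ n"] show ?thesis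
    using T unfolding rr_eq_sum_Bernstein[OF P d] \<alpha>_def[symmetric] x_def[symmetric]
    by (simp add: mult_ac)
qed

lemma rr_ge:
  assumes P: "PP d p > 0" and T: "TT d p \<ge> 0" and d: "d \<ge> 1" and l: "0 < lam" "lam < 1"
  defines "\<alpha> \<equiv> PP d p powr (1 / real d)"
  assumes n: "LL \<alpha> lam \<le> n"
  shows "(sqrt (2 * pi) / exp 2) ^ d * KK \<alpha> d lam * (real n powr (- (real d - 1) / 2) * TT d p ^ n) \<le> rr d p n"
proof -
  have a: "\<alpha> > 0" using P by (simp add: \<alpha>_def)
  define x where "x = \<alpha> / (1 + \<alpha>)"
  have x: "0 < x" "x < 1" "1 - x = 1 / (1 + \<alpha>)" using a by (auto simp: x_def field_simps)
  have v: "x * (1 - x) = \<alpha> / (\<alpha> + 1)\<^sup>2" unfolding x(3) by (simp add: x_def power2_eq_square add.commute)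
  have "n \<ge> 1" using n by (simp add: LL_def Let_def)
  have large: "1 \<le> n * (x * (1 - x))"
    using LL_le_imp_ge[OF a l n] a unfolding v by (simp add: field_simps)
  \<comment> \<open>The variance is at most that of fair trials, which removes \<open>x\<close> from
    the bound.\<close>
  have sq: "sqrt (n * (x * (1 - x))) \<le> sqrt n / 2"
  proof -
    have "x * (1 - x) \<le> 1 / 4" using sum_squares_ge_zero[of "x - 1 / 2" 0] by (simp add: algebra_simps)
    then have "sqrt (n * (x * (1 - x))) \<le> sqrt (n * (1 / 4))"
      by (intro real_sqrt_le_mono mult_left_mono) auto
    then show ?thesis by (simp add: real_sqrt_divide)
  qed
  have "(sqrt (2 * pi) / exp 2) ^ d * KK \<alpha> d lam \<le> (sqrt (2 * pi) / exp 2) ^ d * (2 * (2 * exp (- 1)) ^ d)"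
    using KK_bounds[OF a l, of d] by (intro mult_left_mono) auto
  also have "\<dots> = 2 * (sqrt (2 * pi) / exp 2 * (2 * exp (- 1))) ^ d"
  proof -
    have "a ^ d * (2 * b ^ d) = 2 * (a * b) ^ d" for a b :: real by (simp add: power_mult_distrib)
    then show ?thesis .
  qed
  also have "\<dots> \<le> 2 * (3 / 10) ^ d"
    using sqrt_2pi_constant_le by (intro mult_left_mono power_mono) auto
  \<comment> \<open>The window width enters only to the power \<open>d - 1\<close>, so one factor
    5/2 is left over; it absorbs the 2 coming from \<open>KK\<close>.\<close>
  also have "\<dots> \<le> 5 / 2 * (3 / 10) ^ d" by simp
  also have "\<dots> = (3 / 4) ^ d / (5 / 2) ^ (d - 1)"
  proof -
    have "(3 / 10 :: real) ^ d = (3 / 4) ^ d / (5 / 2) ^ d" by (simp flip: power_divide)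
    moreover have "(5 / 2 :: real) ^ d = 5 / 2 * (5 / 2) ^ (d - 1)" using d by (simp add: power_eq_if)
    ultimately show ?thesis by simp
  qed
  finally have "(sqrt (2 * pi) / exp 2) ^ d * KK \<alpha> d lam * (1 / sqrt n ^ (d - 1))
      \<le> (3 / 4) ^ d / (5 / 2) ^ (d - 1) * (1 / sqrt n ^ (d - 1))"
    by (intro mult_right_mono) auto
  also have "\<dots> = (3 / 4) ^ d / (5 * (sqrt n / 2)) ^ (d - 1)" by (simp flip: power_mult_distrib)
  also have "\<dots> \<le> (3 / 4) ^ d / (5 * sqrt (n * (x * (1 - x)))) ^ (d - 1)"
    using sq large \<open>n \<ge> 1\<close> by (intro divide_left_mono power_mono mult_left_mono mult_pos_pos zero_less_power) auto
  also have "\<dots> \<le> (\<Sum>k\<le>n. Bernstein n k x ^ d)"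
    using x d large by (intro sum_Bernstein_power_ge) auto
  finally have "(sqrt (2 * pi) / exp 2) ^ d * KK \<alpha> d lam * real n powr (- (real d - 1) / 2)
      \<le> (\<Sum>k\<le>n. Bernstein n k x ^ d)"
    unfolding powr_neg_half_diff[OF \<open>n \<ge> 1\<close> d] .
  from mult_left_mono[OF this, of "TT d p ^ n"] show ?thesis
    using T unfolding rr_eq_sum_Bernstein[OF P d] \<alpha>_def[symmetric] x_def[symmetric]
    by (simp add: mult_ac)
qed

text \<open>The \<open>d\<close>-th root of \<open>TT d p\<close> is the geometric mean of the
  failure probabilities plus that of the success probabilities, and the arithmetic means add up to
  1. Hence the bounding series converge on (0, 1).\<close>

lemma TT_le_one:
  assumes d: "d \<ge> 1" and p: "\<And>j. j < d \<Longrightarrow> 0 < p j \<and> p j < 1"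
  shows "TT d p \<le> 1"
proof -
  define e where "e = 1 / real d"
  define g h where "g = (\<Prod>j<d. 1 - p j) powr e" and "h = (\<Prod>j<d. p j) powr e"
  have Q: "QQ d p > 0" unfolding QQ_def using p by (intro prod_pos) auto
  have R: "(\<Prod>j<d. p j) > 0" using p by (intro prod_pos) auto
  have PP: "PP d p = (\<Prod>j<d. p j) / QQ d p" by (simp add: PP_def QQ_def prod_dividef)
  have "g \<le> (\<Sum>j<d. (1 - p j) / card {..<d})" "h \<le> (\<Sum>j<d. p j / card {..<d})"
    unfolding g_def h_def e_def using p d arith_geom_mean[of "{..<d}" "\<lambda>j. 1 - p j"] arith_geom_mean[of "{..<d}" p]
    by (auto simp: less_imp_le lessThan_empty_iff)
  then have "g + h \<le> (\<Sum>j<d. (1 - p j) / card {..<d} + p j / card {..<d})" by (simp add: sum.distrib)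
  also have "\<dots> = 1" using d by (simp flip: add_divide_distrib)
  finally have "(g + h) ^ d \<le> 1" by (intro power_le_one) (auto simp: g_def h_def)
  moreover have "TT d p = (g + h) ^ d"
  proof -
    have "g ^ d = QQ d p" unfolding g_def e_def QQ_def[symmetric]
      using Q d by (simp add: powr_realpow[symmetric] powr_powr)
    moreover have "PP d p powr e = h / g"
      unfolding PP h_def g_def QQ_def[symmetric] by (rule powr_divide)
    moreover have "g > 0" unfolding g_def QQ_def[symmetric] using Q by simp
    ultimately have "g ^ d = QQ d p" "g + h = g * (1 + PP d p powr e)" by (auto simp: field_simps)
    then show ?thesis unfolding TT_def e_def[symmetric] by (simp add: power_mult_distrib)
  qed
  ultimately show ?thesis by simp
qed

section \<open>The renewal equation\<close>

text \<open>An arbitrary block of times and a bare configuration are taken, so that the predicate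
  covers both an initial segment and the block after a first rencontre, and can be evaluated on
  restricted paths.\<close>

definition levels_agree :: "nat \<Rightarrow> nat set \<Rightarrow> (nat \<times> nat \<Rightarrow> bool) \<Rightarrow> bool" where
  "levels_agree d B g \<longleftrightarrow>
     (\<forall>j<d. \<forall>j'<d. card {i \<in> B. g (j, i)} = card {i \<in> B. g (j', i)})"

definition first_rencontre :: "nat \<Rightarrow> nat \<Rightarrow> (nat \<times> nat \<Rightarrow> bool) \<Rightarrow> bool" where
  "first_rencontre d m g \<longleftrightarrow>
     1 \<le> m \<and> levels_agree d {1..m} g \<and> (\<forall>n\<in>{1..<m}. \<not> levels_agree d {1..n} g)"

lemma levels_agree_cong:
  assumes "\<And>j i. j < d \<Longrightarrow> i \<in> B \<Longrightarrow> g (j, i) = h (j, i)"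
  shows "levels_agree d B g \<longleftrightarrow> levels_agree d B h"
proof -
  have "{i \<in> B. g (j, i)} = {i \<in> B. h (j, i)}" if "j < d" for j using assms that by auto
  then show ?thesis by (simp add: levels_agree_def)
qed

lemma first_rencontre_cong:
  assumes "\<And>j i. j < d \<Longrightarrow> i \<in> {1..m} \<Longrightarrow> g (j, i) = h (j, i)"
  shows "first_rencontre d m g \<longleftrightarrow> first_rencontre d m h"
proof -
  have "levels_agree d {1..n} g \<longleftrightarrow> levels_agree d {1..n} h" if "n \<le> m" for n
    using assms that by (intro levels_agree_cong) auto
  then show ?thesis by (auto simp: first_rencontre_def)
qed

lemma first_rencontre_unique:
  assumes "first_rencontre d m g" "first_rencontre d n g"
  shows "m = n"
  using assms by (metis atLeastLessThan_iff first_rencontre_def nat_neq_iff)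

text \<open>Success counts add up over \<open>{1..m}\<close> and \<open>{m<..n}\<close>. Once the
  levels agree at \<open>m\<close>, agreement at \<open>n\<close> therefore amounts to agreement
  over the later block; the witness is the least time of agreement.\<close>

lemma levels_agree_iff_first_rencontre:
  assumes "n \<ge> 1"
  shows "levels_agree d {1..n} g \<longleftrightarrow> (\<exists>m\<in>{1..n}. first_rencontre d m g \<and> levels_agree d {m<..n} g)"
proof -
  have split: "card {i \<in> {1..n}. g (j, i)} = card {i \<in> {1..m}. g (j, i)} + card {i \<in> {m<..n}. g (j, i)}"
    if "m \<le> n" for j m
  proof -
    have "{i \<in> {1..n}. g (j, i)} = {i \<in> {1..m}. g (j, i)} \<union> {i \<in> {m<..n}. g (j, i)}" using that by auto
    then show ?thesis by (simp only:) (rule card_Un_disjoint; auto)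
  qed
  show ?thesis
  proof
    assume n: "levels_agree d {1..n} g"
    define m where "m = (LEAST m. 1 \<le> m \<and> levels_agree d {1..m} g)"
    have "1 \<le> m \<and> levels_agree d {1..m} g" 
      unfolding m_def by (rule LeastI[where k = n]) (use n assms in simp)
    moreover have "m \<le> n" 
      unfolding m_def by (rule Least_le) (use n assms in simp)
    moreover have "\<not> levels_agree d {1..k} g" if "k \<in> {1..<m}" for k
      using not_less_Least[of k "\<lambda>m. 1 \<le> m \<and> levels_agree d {1..m} g"] that by (auto simp: m_def)
    ultimately have m: "first_rencontre d m g" "m \<in> {1..n}" by (auto simp: first_rencontre_def)
    moreover have "levels_agree d {m<..n} g"
    proof (unfold levels_agree_def, intro allI impI)
      fix j j' assume "j < d" "j' < d"
      then have "card {i \<in> {1..n}. g (j, i)} = card {i \<in> {1..n}. g (j', i)}"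
        "card {i \<in> {1..m}. g (j, i)} = card {i \<in> {1..m}. g (j', i)}"
        using n m unfolding levels_agree_def first_rencontre_def by blast+
      then show "card {i \<in> {m<..n}. g (j, i)} = card {i \<in> {m<..n}. g (j', i)}"
        using split[of m j] split[of m j'] m by simp
    qed
    ultimately show "\<exists>m\<in>{1..n}. first_rencontre d m g \<and> levels_agree d {m<..n} g" by blast
  next
    assume "\<exists>m\<in>{1..n}. first_rencontre d m g \<and> levels_agree d {m<..n} g"
    then obtain m where m: "m \<le> n" "levels_agree d {1..m} g" "levels_agree d {m<..n} g"
      by (auto simp: first_rencontre_def)
    show "levels_agree d {1..n} g"
    proof (unfold levels_agree_def, intro allI impI)
      fix j j' assume "j < d" "j' < d"
      then have "card {i \<in> {1..m}. g (j, i)} = card {i \<in> {1..m}. g (j', i)}"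
        "card {i \<in> {m<..n}. g (j, i)} = card {i \<in> {m<..n}. g (j', i)}"
        using m unfolding levels_agree_def by blast+
      then show "card {i \<in> {1..n}. g (j, i)} = card {i \<in> {1..n}. g (j', i)}"
        using split[OF m(1)] by simp
    qed
  qed
qed

lemma rencontre_time_eq_enat_iff:
  "rencontre_time d X \<omega> = enat m \<longleftrightarrow> first_rencontre d m (\<lambda>(j, i). X j i \<omega>)"
proof -
  let ?A = "\<lambda>n. n \<ge> 1 \<and> (\<forall>j<d. \<forall>j'<d. S_count X j n \<omega> = S_count X j' n \<omega>)"
  have A: "?A n \<longleftrightarrow> 1 \<le> n \<and> levels_agree d {1..n} (\<lambda>(j, i). X j i \<omega>)" for n
    by (simp add: levels_agree_def S_count_def)
  have "rencontre_time d X \<omega> = enat m \<longleftrightarrow> ?A m \<and> (\<forall>n<m. \<not> ?A n)"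
  proof (cases "\<exists>n. ?A n")
    case True
    then have r: "rencontre_time d X \<omega> = enat (LEAST n. ?A n)" by (auto simp: rencontre_time_def)
    show ?thesis
    proof
      assume "rencontre_time d X \<omega> = enat m"
      then have m: "m = (LEAST n. ?A n)" by (simp only: r enat.inject)
      show "?A m \<and> (\<forall>n<m. \<not> ?A n)"
        unfolding m by (intro conjI allI impI not_less_Least) (use LeastI_ex[OF True] in \<open>iprover+\<close>)
    next
      assume "?A m \<and> (\<forall>n<m. \<not> ?A n)"
      then have "(LEAST n. ?A n) = m" by (intro Least_equality) (use not_le in blast)+
      then show "rencontre_time d X \<omega> = enat m" by (simp only: r)
    qed
  next
    case False
    then show ?thesis by (auto simp: rencontre_time_def)
  qed
  also have "\<dots> \<longleftrightarrow> first_rencontre d m (\<lambda>(j, i). X j i \<omega>)"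
    unfolding A first_rencontre_def by auto
  finally show ?thesis .
qed

section \<open>Finite-dimensional probabilities of the walks\<close>

locale bernoulli_walks = prob_space M for M :: "'a measure" +
  fixes X :: "nat \<Rightarrow> nat \<Rightarrow> 'a \<Rightarrow> bool" and d :: nat and p :: "nat \<Rightarrow> real"
  assumes d_pos: "d \<ge> 1"
    and p_bounds: "\<And>j. j < d \<Longrightarrow> 0 < p j \<and> p j < 1"
    and indep: "indep_vars (\<lambda>_. count_space UNIV) (\<lambda>(j, k). X j k) ({..<d} \<times> {1..})"
    and prob_X: "\<And>j k. j < d \<Longrightarrow> k \<ge> 1 \<Longrightarrow> prob {\<omega> \<in> space M. X j k \<omega>} = p j"
begin

abbreviation path :: "'a \<Rightarrow> nat \<times> nat \<Rightarrow> bool" where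
  "path \<omega> \<equiv> (\<lambda>(j, i). X j i \<omega>)"

lemma measurable_X: "j < d \<Longrightarrow> 1 \<le> i \<Longrightarrow> X j i \<in> measurable M (count_space UNIV)"
  using indep unfolding indep_vars_def by auto

lemma sets_X_eq: "j < d \<Longrightarrow> 1 \<le> i \<Longrightarrow> {\<omega> \<in> space M. X j i \<omega> = b} \<in> events"
  using measurable_sets[OF measurable_X, of j i "{b}"] by (simp add: vimage_def Int_def conj_commute)

lemma prob_X_eq:
  assumes "j < d" "1 \<le> i"
  shows "prob {\<omega> \<in> space M. X j i \<omega> = b} = (if b then p j else 1 - p j)"
proof (cases b)
  case True
  then show ?thesis using prob_X[OF assms] by simp
next
  case False
  have "{\<omega> \<in> space M. X j i \<omega> = b} = space M - {\<omega> \<in> space M. X j i \<omega> = True}" using False by auto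
  then show ?thesis
    using prob_compl[OF sets_X_eq[OF assms, of True]] prob_X[OF assms] False by simp
qed

lemma successes_event:
  assumes "finite B" "B \<subseteq> {1..}"
  shows "{\<omega> \<in> space M. \<forall>j<d. {i \<in> B. X j i \<omega>} = C j} \<in> events"
proof (cases "\<forall>j<d. C j \<subseteq> B")
  case True
  have "{\<omega> \<in> space M. \<forall>j<d. {i \<in> B. X j i \<omega>} = C j} =
      space M \<inter> (\<Inter>x\<in>{..<d} \<times> B. {\<omega> \<in> space M. X (fst x) (snd x) \<omega> = (snd x \<in> C (fst x))})"
    using True by fastforce
  also have "\<dots> \<in> events"
    using assms d_pos by (cases "B = {}") (auto intro!: sets.Int sets.finite_INT sets_X_eq simp: Times_empty lessThan_empty_iff)
  finally show ?thesis .
next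
  case False
  then have empty: "{\<omega> \<in> space M. \<forall>j<d. {i \<in> B. X j i \<omega>} = C j} = {}" by blast
  show ?thesis unfolding empty by simp
qed

text \<open>Prescribing the success sets fixes every trial indexed by
  \<open>{..<d} \<times> B\<close>. Independence gives a product over this rectangle, which is then
  grouped by walk.\<close>

lemma prob_successes:
  assumes B: "finite B" "B \<subseteq> {1..}" and C: "\<And>j. j < d \<Longrightarrow> C j \<subseteq> B"
  shows "prob {\<omega> \<in> space M. \<forall>j<d. {i \<in> B. X j i \<omega>} = C j} =
    (\<Prod>j<d. p j ^ card (C j) * (1 - p j) ^ (card B - card (C j)))"
\<comment> \<open>The product formula for independent variables needs a nonempty index set.\<close>
proof (cases "B = {}")
  case True
  then have "{\<omega> \<in> space M. \<forall>j<d. {i \<in> B. X j i \<omega>} = C j} = space M" using C by auto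
  with True C show ?thesis by (auto simp: prob_space)
next
  case False
  have 0: "0 < d" using d_pos by simp
  have vim: "(case x of (j, k) \<Rightarrow> X j k) -` {snd x \<in> C (fst x)} \<inter> space M =
      {\<omega> \<in> space M. X (fst x) (snd x) \<omega> = (snd x \<in> C (fst x))}" for x
    by (auto simp: case_prod_beta)
  have "{\<omega> \<in> space M. \<forall>j<d. {i \<in> B. X j i \<omega>} = C j} =
      (\<Inter>x\<in>{..<d} \<times> B. (case x of (j, k) \<Rightarrow> X j k) -` {snd x \<in> C (fst x)} \<inter> space M)"
    unfolding vim using C False 0 by fastforce
  also have "prob \<dots> = (\<Prod>x\<in>{..<d} \<times> B. prob ((case x of (j, k) \<Rightarrow> X j k) -` {snd x \<in> C (fst x)} \<inter> space M))"
    using B False 0 by (intro indep_varsD[OF indep]) (auto simp: lessThan_empty_iff)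
  also have "\<dots> = (\<Prod>(j, i)\<in>{..<d} \<times> B. if i \<in> C j then p j else 1 - p j)"
    unfolding vim using B by (intro prod.cong) (auto simp: prob_X_eq)
  also have "\<dots> = (\<Prod>j<d. \<Prod>i\<in>B. if i \<in> C j then p j else 1 - p j)"
    by (simp add: prod.cartesian_product)
  also have "\<dots> = (\<Prod>j<d. p j ^ card (C j) * (1 - p j) ^ (card B - card (C j)))"
  proof (rule prod.cong[OF refl])
    fix j assume "j \<in> {..<d}"
    then have "B \<inter> {i. i \<in> C j} = C j" "B \<inter> - {i. i \<in> C j} = B - C j" "C j \<subseteq> B"
      using C[of j] by auto
    then show "(\<Prod>i\<in>B. if i \<in> C j then p j else 1 - p j) =
        p j ^ card (C j) * (1 - p j) ^ (card B - card (C j))"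
      using B by (simp add: prod.If_cases card_Diff_subset finite_subset)
  qed
  finally show ?thesis .
qed

lemma prod_weights:
  assumes "k \<le> n"
  shows "(\<Prod>j<d. p j ^ k * (1 - p j) ^ (n - k)) = QQ d p ^ n * PP d p ^ k"
proof -
  have "p j ^ k * (1 - p j) ^ (n - k) = (1 - p j) ^ n * (p j / (1 - p j)) ^ k" if "j < d" for j
    using p_bounds[OF that] assms by (simp add: power_divide power_diff)
  then show ?thesis
    unfolding QQ_def PP_def prod_power_distrib prod.distrib[symmetric] by (intro prod.cong) auto
qed

text \<open>The event is partitioned by the common level \<open>k\<close> and the \<open>d\<close>
  success sets of size \<open>k\<close>. With \<open>n = card B\<close> there are
  \<open>(n choose k) ^ d\<close> choices, each of probability
  \<open>QQ d p ^ n * PP d p ^ k\<close>.\<close>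

lemma prob_levels_agree:
  assumes B: "finite B" "B \<subseteq> {1..}"
  shows "{\<omega> \<in> space M. levels_agree d B (path \<omega>)} \<in> events"
    and "prob {\<omega> \<in> space M. levels_agree d B (path \<omega>)} = rr d p (card B)"
proof -
  define n where "n = card B"
  \<comment> \<open>Extensional functions are determined by their values below \<open>d\<close>;
    otherwise distinct indices could describe the same event and disjointness would fail.\<close>
  define S where "S = (SIGMA k:{..n}. PiE {..<d} (\<lambda>_. {C. C \<subseteq> B \<and> card C = k}))"
  define E where "E = (\<lambda>x::nat \<times> (nat \<Rightarrow> nat set). {\<omega> \<in> space M. \<forall>j<d. {i \<in> B. X j i \<omega>} = snd x j})"
  have 0: "0 < d" using d_pos by simp
  have finC: "finite {C. C \<subseteq> B \<and> card C = k}" for k using B by simp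
  have finS: "finite S" unfolding S_def using finC by (intro finite_SigmaI finite_PiE) auto
  have eq: "{\<omega> \<in> space M. levels_agree d B (path \<omega>)} = (\<Union>x\<in>S. E x)"
  proof (intro equalityI subsetI)
    fix \<omega> assume "\<omega> \<in> {\<omega> \<in> space M. levels_agree d B (path \<omega>)}"
    then have w: "\<omega> \<in> space M" "levels_agree d B (path \<omega>)" by simp_all
    obtain k where k: "\<And>j. j < d \<Longrightarrow> card {i \<in> B. X j i \<omega>} = k"
    proof
      fix j assume "j < d"
      with w(2) 0 show "card {i \<in> B. X j i \<omega>} = card {i \<in> B. X 0 i \<omega>}"
        unfolding levels_agree_def case_prod_conv by blast
    qed
    have "k \<le> n" unfolding n_def k[OF 0, symmetric] using B by (intro card_mono) auto
    then have "(k, \<lambda>j\<in>{..<d}. {i \<in> B. X j i \<omega>}) \<in> S"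
      unfolding S_def using k by auto
    moreover have "\<omega> \<in> E (k, \<lambda>j\<in>{..<d}. {i \<in> B. X j i \<omega>})"
      using w by (simp add: E_def)
    ultimately show "\<omega> \<in> (\<Union>x\<in>S. E x)" by blast
  next
    fix \<omega> assume "\<omega> \<in> (\<Union>x\<in>S. E x)"
    then obtain k C where "C \<in> PiE {..<d} (\<lambda>_. {C. C \<subseteq> B \<and> card C = k})" "\<omega> \<in> space M"
      "\<forall>j<d. {i \<in> B. X j i \<omega>} = C j"
      by (auto simp: S_def E_def)
    then show "\<omega> \<in> {\<omega> \<in> space M. levels_agree d B (path \<omega>)}"
      by (auto simp: levels_agree_def PiE_iff)
  qed
  have ev: "E x \<in> events" for x unfolding E_def by (rule successes_event[OF B])
  show "{\<omega> \<in> space M. levels_agree d B (path \<omega>)} \<in> events"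
    unfolding eq using ev finS by (intro sets.finite_UN) auto
  have disj: "disjoint_family_on E S"
  proof (unfold disjoint_family_on_def, intro ballI impI equals0I)
    fix x y \<omega> assume xy: "x \<in> S" "y \<in> S" "x \<noteq> y" "\<omega> \<in> E x \<inter> E y"
    have eqj: "snd x j = snd y j" if "j < d" for j
      using xy(4) that unfolding E_def by blast
    have x: "snd x \<in> PiE {..<d} (\<lambda>_. {C. C \<subseteq> B \<and> card C = fst x})"
      using xy(1) unfolding S_def by (cases x) simp
    have y: "snd y \<in> PiE {..<d} (\<lambda>_. {C. C \<subseteq> B \<and> card C = fst y})"
      using xy(2) unfolding S_def by (cases y) simp
    have "snd x = snd y" 
      using x y eqj by (intro extensionalityI[of _ "{..<d}"]) (auto simp: PiE_def)
    moreover have "fst x = fst y"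
      using PiE_mem[OF x, of 0] PiE_mem[OF y, of 0] eqj[OF 0] 0 by simp
    ultimately have "x = y" by (simp add: prod_eq_iff)
    with xy(3) show False ..
  qed
  have "prob {\<omega> \<in> space M. levels_agree d B (path \<omega>)} = (\<Sum>x\<in>S. prob (E x))"
    unfolding eq using ev finS disj by (intro finite_measure_finite_Union) auto
  also have "\<dots> = (\<Sum>x\<in>S. QQ d p ^ n * PP d p ^ fst x)"
  proof (rule sum.cong[OF refl])
    fix x assume "x \<in> S"
    then have le: "fst x \<le> n" and pi: "snd x \<in> PiE {..<d} (\<lambda>_. {C. C \<subseteq> B \<and> card C = fst x})"
      unfolding S_def by (cases x; simp)+
    have x: "snd x j \<subseteq> B" "card (snd x j) = fst x" if "j < d" for j
      using PiE_mem[OF pi, of j] that by auto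
    have "prob (E x) = (\<Prod>j<d. p j ^ card (snd x j) * (1 - p j) ^ (n - card (snd x j)))"
      unfolding E_def n_def using x by (intro prob_successes[OF B]) auto
    also have "\<dots> = (\<Prod>j<d. p j ^ fst x * (1 - p j) ^ (n - fst x))"
      using x by (intro prod.cong) auto
    also have "\<dots> = QQ d p ^ n * PP d p ^ fst x" by (rule prod_weights[OF le])
    finally show "prob (E x) = QQ d p ^ n * PP d p ^ fst x" .
  qed
  also have "\<dots> = (\<Sum>k\<le>n. \<Sum>C\<in>PiE {..<d} (\<lambda>_. {C. C \<subseteq> B \<and> card C = k}). QQ d p ^ n * PP d p ^ k)"
    unfolding S_def using finC by (subst sum.Sigma) (auto intro!: finite_PiE sum.cong)
  also have "\<dots> = (\<Sum>k\<le>n. QQ d p ^ n * (real (n choose k) ^ d * PP d p ^ k))"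
    using B by (intro sum.cong) (auto simp: card_PiE n_subsets n_def)
  also have "\<dots> = rr d p n" by (simp add: rr_def sum_distrib_left)
  finally show "prob {\<omega> \<in> space M. levels_agree d B (path \<omega>)} = rr d p (card B)" by (simp add: n_def)
qed

lemma rr_zero: "rr d p 0 = 1"
  by (simp add: rr_def)

lemma rr_eq_prob: "rr d p n = prob {\<omega> \<in> space M. levels_agree d {1..n} (path \<omega>)}"
  by (subst prob_levels_agree) auto

lemma rr_nonneg: "0 \<le> rr d p n"
  by (simp add: rr_eq_prob)

lemma rr_le_one: "rr d p n \<le> 1"
  by (simp add: rr_eq_prob)

lemma first_rencontre_event: "{\<omega> \<in> space M. first_rencontre d m (path \<omega>)} \<in> events"
proof -
  have "{\<omega> \<in> space M. first_rencontre d m (path \<omega>)} =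
      (if 1 \<le> m then {\<omega> \<in> space M. levels_agree d {1..m} (path \<omega>)} -
        (\<Union>n\<in>{1..<m}. {\<omega> \<in> space M. levels_agree d {1..n} (path \<omega>)}) else {})"
    by (auto simp: first_rencontre_def)
  moreover have "{\<omega> \<in> space M. levels_agree d {1..n} (path \<omega>)} \<in> events" for n
    by (rule prob_levels_agree) auto
  ultimately show ?thesis by auto
qed

text \<open>The first event depends only on trials up to \<open>m\<close>, the second only on later
  ones, so they are independent. The probability of agreement over a block depends only on its
  length.\<close>

lemma prob_first_rencontre_and_levels_agree:
  assumes "m \<le> n"
  shows "prob {\<omega> \<in> space M. first_rencontre d m (path \<omega>) \<and> levels_agree d {m<..n} (path \<omega>)} =
    prob {\<omega> \<in> space M. first_rencontre d m (path \<omega>)} * rr d p (n - m)"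
proof -
  define I J where "I = {..<d} \<times> {1..m}" and "J = {..<d} \<times> {m<..n}"
  define U where "U = (\<lambda>\<omega>. restrict (\<lambda>i. (case i of (j, k) \<Rightarrow> X j k) \<omega>) I)"
  define V where "V = (\<lambda>\<omega>. restrict (\<lambda>i. (case i of (j, k) \<Rightarrow> X j k) \<omega>) J)"
  \<comment> \<open>A finite product of these discrete spaces is discrete, so every set of
    restricted configurations is measurable.\<close>
  have cs: "PiM K (\<lambda>_. count_space (UNIV :: bool set)) = count_space (PiE K (\<lambda>_. UNIV))"
    if "finite K" for K :: "(nat \<times> nat) set"
    using that by (rule count_space_PiM_finite) auto
  have "indep_var (PiM I (\<lambda>_. count_space UNIV)) U (PiM J (\<lambda>_. count_space UNIV)) V"
    unfolding U_def V_def
    by (rule indep_var_restrict[OF indep]) (auto simp: I_def J_def)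
  then have uv: "indep_var (count_space (PiE I (\<lambda>_. UNIV))) U (count_space (PiE J (\<lambda>_. UNIV))) V"
    by (simp add: cs I_def J_def)
  define A where "A = {g \<in> PiE I (\<lambda>_. UNIV). first_rencontre d m g}"
  define A' where "A' = {g \<in> PiE J (\<lambda>_. UNIV). levels_agree d {m<..n} g}"
  have "U \<omega> \<in> A \<longleftrightarrow> first_rencontre d m (path \<omega>)" for \<omega>
  proof -
    have "first_rencontre d m (U \<omega>) \<longleftrightarrow> first_rencontre d m (path \<omega>)"
      by (rule first_rencontre_cong) (auto simp: U_def I_def)
    then show ?thesis by (auto simp: A_def U_def)
  qed
  then have UA: "U -` A \<inter> space M = {\<omega> \<in> space M. first_rencontre d m (path \<omega>)}" by auto
  have V': "V \<omega> \<in> A' \<longleftrightarrow> levels_agree d {m<..n} (path \<omega>)" for \<omega>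
  proof -
    have "levels_agree d {m<..n} (V \<omega>) \<longleftrightarrow> levels_agree d {m<..n} (path \<omega>)"
      by (rule levels_agree_cong) (auto simp: V_def J_def)
    then show ?thesis by (auto simp: A'_def V_def)
  qed
  then have VA: "V -` A' \<inter> space M = {\<omega> \<in> space M. levels_agree d {m<..n} (path \<omega>)}" by auto
  have "{\<omega> \<in> space M. first_rencontre d m (path \<omega>) \<and> levels_agree d {m<..n} (path \<omega>)} =
      (U -` A \<inter> space M) \<inter> (V -` A' \<inter> space M)"
    unfolding UA VA by blast
  also have "\<dots> = (\<lambda>x. (U x, V x)) -` (A \<times> A') \<inter> space M" by blast
  also have "prob \<dots> = prob (U -` A \<inter> space M) * prob (V -` A' \<inter> space M)"
    by (rule indep_varD[OF uv]) (auto simp: A_def A'_def)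
  also have "prob (V -` A' \<inter> space M) = rr d p (n - m)"
    unfolding VA by (subst prob_levels_agree) auto
  finally show ?thesis unfolding UA .
qed

section \<open>The law of the first rencontre time\<close>

definition first_prob :: "nat \<Rightarrow> real" where
  "first_prob m = prob {\<omega> \<in> space M. rencontre_time d X \<omega> = enat m}"

lemma first_prob_eq: "first_prob m = prob {\<omega> \<in> space M. first_rencontre d m (path \<omega>)}"
  by (simp add: first_prob_def rencontre_time_eq_enat_iff)

text \<open>Agreement at \<open>n\<close> is split by the time \<open>m\<close> of the first
  rencontre; the pieces are disjoint because this time is unique, and each factors by
  independence.\<close>

lemma renewal_equation:
  assumes "n \<ge> 1"
  shows "rr d p n = (\<Sum>m=1..n. first_prob m * rr d p (n - m))"
proof -
  let ?E = "\<lambda>m. {\<omega> \<in> space M. first_rencontre d m (path \<omega>) \<and> levels_agree d {m<..n} (path \<omega>)}"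
  have ev: "?E m \<in> events" for m
  proof -
    have "?E m = {\<omega> \<in> space M. first_rencontre d m (path \<omega>)} \<inter> {\<omega> \<in> space M. levels_agree d {m<..n} (path \<omega>)}"
      by auto
    also have "\<dots> \<in> events" by (intro sets.Int first_rencontre_event prob_levels_agree) auto
    finally show ?thesis .
  qed
  note rr_eq_prob
  also have "{\<omega> \<in> space M. levels_agree d {1..n} (path \<omega>)} = (\<Union>m\<in>{1..n}. ?E m)"
    unfolding levels_agree_iff_first_rencontre[OF assms] by blast
  also have "prob \<dots> = (\<Sum>m=1..n. prob (?E m))"
    using ev first_rencontre_unique
    by (intro finite_measure_finite_Union) (fastforce simp: disjoint_family_on_def)+
  also have "\<dots> = (\<Sum>m=1..n. first_prob m * rr d p (n - m))"
    by (intro sum.cong) (auto simp: prob_first_rencontre_and_levels_agree first_prob_eq)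
  finally show ?thesis .
qed

lemma first_prob_zero: "first_prob 0 = 0"
  by (simp add: first_prob_eq first_rencontre_def)

lemma first_prob_nonneg: "0 \<le> first_prob m"
  by (simp add: first_prob_def)

lemma rencontre_time_event: "{\<omega> \<in> space M. rencontre_time d X \<omega> = enat m} \<in> events"
  unfolding rencontre_time_eq_enat_iff by (rule first_rencontre_event)

text \<open>Numerator and denominator are split over the finite values of the time. Working in
  \<open>ennreal\<close> makes the exchange of sum and integral unconditional and admits an infinite
  expectation.\<close>

lemma cond_exp_finite_rencontre_time:
  "cond_exp_finite M (rencontre_time d X) =
     (\<Sum>m. ennreal (real m * first_prob m)) / (\<Sum>m. ennreal (first_prob m))"
proof -
  let ?J = "rencontre_time d X"
  let ?E = "\<lambda>m. {\<omega> \<in> space M. ?J \<omega> = enat m}"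
  have E: "emeasure M (?E m) = ennreal (first_prob m)" for m
    by (simp add: first_prob_def emeasure_eq_measure)
  have "{\<omega> \<in> space M. ?J \<omega> < \<infinity>} = (\<Union>m. ?E m)" by auto
  also have "emeasure M \<dots> = (\<Sum>m. emeasure M (?E m))"
    by (intro suminf_emeasure[symmetric]) (auto simp: disjoint_family_on_def rencontre_time_event)
  finally have den: "emeasure M {\<omega> \<in> space M. ?J \<omega> < \<infinity>} = (\<Sum>m. ennreal (first_prob m))"
    by (simp add: E)
  have "(\<integral>\<^sup>+ \<omega>. (if ?J \<omega> < \<infinity> then ennreal (real (the_enat (?J \<omega>))) else 0) \<partial>M) =
      (\<integral>\<^sup>+ \<omega>. (\<Sum>m. ennreal (real m) * indicator (?E m) \<omega>) \<partial>M)"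
  proof (rule nn_integral_cong)
    fix \<omega> assume w: "\<omega> \<in> space M"
    show "(if ?J \<omega> < \<infinity> then ennreal (real (the_enat (?J \<omega>))) else 0) =
        (\<Sum>m. ennreal (real m) * indicator (?E m) \<omega>)"
    proof (cases "?J \<omega>")
      case (enat k)
      have "(\<Sum>m. ennreal (real m) * indicator (?E m) \<omega>) = (\<Sum>m\<in>{k}. ennreal (real m) * indicator (?E m) \<omega>)"
        by (rule suminf_finite) (auto simp: enat)
      then show ?thesis using enat w by simp
    qed simp
  qed
  also have "\<dots> = (\<Sum>m. \<integral>\<^sup>+ \<omega>. ennreal (real m) * indicator (?E m) \<omega> \<partial>M)"
    by (intro nn_integral_suminf borel_measurable_times_ennreal borel_measurable_const
        borel_measurable_indicator rencontre_time_event)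
  also have "\<dots> = (\<Sum>m. ennreal (real m * first_prob m))"
    by (simp add: nn_integral_cmult_indicator rencontre_time_event E ennreal_mult first_prob_nonneg)
  finally show ?thesis unfolding cond_exp_finite_def den by simp
qed

lemma first_prob_summable: "summable first_prob"
proof -
  have "first_prob sums prob (\<Union>m. {\<omega> \<in> space M. rencontre_time d X \<omega> = enat m})"
    unfolding first_prob_def
    by (rule finite_measure_UNION) (auto simp: disjoint_family_on_def rencontre_time_event)
  then show ?thesis by (rule sums_summable)
qed

end

section \<open>Generating functions at the boundary\<close>

text \<open>Abel's theorem for nonnegative coefficients, transferred from \<open>ennreal\<close> to
  a finite limit.\<close>

lemma powser_tendsto_suminf:
  fixes c :: "nat \<Rightarrow> real"
  assumes "\<And>n. 0 \<le> c n" "summable c"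
  shows "((\<lambda>x. \<Sum>n. c n * x ^ n) \<longlongrightarrow> (\<Sum>n. c n)) (at_left 1)"
proof (rule tendsto_ennrealD)
  have "((\<lambda>x. ennreal (\<Sum>n. c n * x ^ n)) \<longlongrightarrow> (\<Sum>n. ennreal (c n))) (at_left 1)"
    using assms(1)
  proof (rule power_series_tendsto_at_left)
    fix x :: real assume "0 \<le> x" "x < 1"
    then show "summable (\<lambda>n. c n * x ^ n)"
      using assms by (intro summable_comparison_test'[OF assms(2), of 0])
        (auto simp: abs_mult power_le_one mult_left_le)
  qed
  also have "(\<Sum>n. ennreal (c n)) = ennreal (\<Sum>n. c n)" using assms by (rule suminf_ennreal2)
  finally show "((\<lambda>x. ennreal (\<Sum>n. c n * x ^ n)) \<longlongrightarrow> ennreal (\<Sum>n. c n)) (at_left 1)" .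
  show "\<forall>\<^sub>F x in at_left 1. 0 \<le> (\<Sum>n. c n * x ^ n)"
  proof (rule eventually_at_left_1)
    fix x :: real assume x: "0 < x" "x < 1"
    then have "summable (\<lambda>n. c n * x ^ n)"
      using assms by (intro summable_comparison_test'[OF assms(2), of 0])
        (auto simp: abs_mult power_le_one mult_left_le)
    then show "0 \<le> (\<Sum>n. c n * x ^ n)" using assms x by (intro suminf_nonneg) auto
  qed
qed (use assms in \<open>auto intro: suminf_nonneg\<close>)

text \<open>The numerator may tend to infinity, so the quotient is treated as a product with the
  inverse of the denominator, whose limit is finite and positive.\<close>

lemma tendsto_ennreal_divide_real:
  fixes f g :: "'b \<Rightarrow> real"
  assumes f: "((\<lambda>x. ennreal (f x)) \<longlongrightarrow> A) F" and g: "(g \<longlongrightarrow> b) F" "b > 0"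
    and nonneg: "\<forall>\<^sub>F x in F. 0 \<le> f x"
  shows "((\<lambda>x. ennreal (f x / g x)) \<longlongrightarrow> A / ennreal b) F"
proof -
  have "((\<lambda>x. inverse (g x)) \<longlongrightarrow> inverse b) F" using g by (intro tendsto_inverse) auto
  then have "((\<lambda>x. ennreal (f x) * ennreal (inverse (g x))) \<longlongrightarrow> A * ennreal (inverse b)) F"
    using g(2) by (intro tendsto_mult_ennreal f tendsto_ennrealI) auto
  moreover have "A * ennreal (inverse b) = A / ennreal b"
    using g(2) by (simp add: divide_ennreal_def inverse_ennreal)
  moreover have "\<forall>\<^sub>F x in F. ennreal (f x) * ennreal (inverse (g x)) = ennreal (f x / g x)"
    using nonneg order_tendstoD(1)[OF g]
    by eventually_elim (simp add: divide_inverse ennreal_mult)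
  ultimately show ?thesis by (simp add: tendsto_cong)
qed

text \<open>The term at \<open>n = 0\<close> vanishes, so the index shift in \<open>diffs\<close>
  does not change the sum.\<close>

lemma suminf_ennreal_diffs:
  fixes c :: "nat \<Rightarrow> real"
  shows "(\<Sum>n. ennreal (diffs c n)) = (\<Sum>n. ennreal (real n * c n))"
  using suminf_offset[of "\<lambda>n. ennreal (real n * c n)" 1] by (simp add: diffs_def)

text \<open>The null recurrent case \<open>d = 3\<close>, \<open>T = 1\<close>: the numerator grows like \<open>1 / (1 - x)\<close>, the denominator
  only like the square of its logarithm.\<close>

lemma powser_ratio_at_top:
  fixes a b :: "nat \<Rightarrow> real"
  assumes a: "\<And>n. 0 \<le> a n" "\<And>x. 0 < x \<Longrightarrow> x < 1 \<Longrightarrow> summable (\<lambda>n. diffs a n * x ^ n)"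
    and b: "b 0 = 0" "\<And>n. 0 \<le> b n" "b 1 > 0"
    and c: "c > 0" "\<And>n. N \<le> n \<Longrightarrow> c / real n \<le> a n" and N: "N \<ge> 1"
    and C: "C > 0" "\<And>n. 1 \<le> n \<Longrightarrow> b n \<le> C / real n"
  shows "LIM x at_left 1. (\<Sum>n. diffs a n * x ^ n) / ((\<Sum>n. b n * x ^ n) * (1 + (\<Sum>n. b n * x ^ n))) :> at_top"
proof -
  \<comment> \<open>The factor \<open>c / 2\<close> comes from \<open>x ^ N > 1 / 2\<close> near 1,
    and \<open>C * - ln (1 - x)\<close> is the sum of \<open>C / n * x ^ n\<close>.\<close>
  define h where "h = (\<lambda>x::real. (c / 2) / (1 - x) / ((C * - ln (1 - x)) * (1 + C * - ln (1 - x))))"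
  have "((\<lambda>x::real. x ^ N) \<longlongrightarrow> 1 ^ N) (at_left 1)" by (intro tendsto_intros)
  then have half: "\<forall>\<^sub>F x::real in at_left 1. 1 / 2 < x ^ N" by (rule order_tendstoD) simp
  have ev01: "\<forall>\<^sub>F x::real in at_left 1. 0 < x \<and> x < 1" by (rule eventually_at_left_1) simp
  have "LIM x at_left 1. h x :> at_top" unfolding h_def using c(1) C(1) by real_asymp
  moreover have "\<forall>\<^sub>F x in at_left 1.
      h x \<le> (\<Sum>n. diffs a n * x ^ n) / ((\<Sum>n. b n * x ^ n) * (1 + (\<Sum>n. b n * x ^ n)))"
    using half ev01
  proof eventually_elim
    case (elim x)
    then have x: "0 < x" "x < 1" "norm x < 1" by auto
    have "(\<lambda>n. x ^ N * c * x ^ n) sums (x ^ N * c * (1 / (1 - x)))"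
      by (intro sums_mult geometric_sums x)
    then have "x ^ N * c * (1 / (1 - x)) \<le> (\<Sum>n. diffs a (n + N) * x ^ (n + N))"
    proof (rule sums_le[rotated])
      show "(\<lambda>n. diffs a (n + N) * x ^ (n + N)) sums (\<Sum>n. diffs a (n + N) * x ^ (n + N))"
        using a(2)[OF x(1,2)] by (intro summable_sums summable_ignore_initial_segment)
      fix n
      \<comment> \<open>Differentiation multiplies by the index, so the bound \<open>c / n\<close>
        becomes the constant \<open>c\<close> and the tail dominates a geometric series.\<close>
      have "c \<le> diffs a (n + N)" using c(2)[of "Suc (n + N)"] by (simp add: diffs_def field_simps)
      then show "x ^ N * c * x ^ n \<le> diffs a (n + N) * x ^ (n + N)"
        using x by (simp add: power_add mult_ac mult_left_mono)
    qed
    also have "\<dots> \<le> (\<Sum>n. diffs a n * x ^ n)"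
      using suminf_split_initial_segment[OF a(2)[OF x(1,2)], of N] a(1) x
      by (simp add: diffs_def sum_nonneg)
    finally have num: "(c / 2) / (1 - x) \<le> (\<Sum>n. diffs a n * x ^ n)"
    proof (rule order_trans[rotated])
      have "1 / 2 * c * (1 / (1 - x)) \<le> x ^ N * c * (1 / (1 - x))"
        using elim x c(1) by (intro mult_right_mono) auto
      then show "(c / 2) / (1 - x) \<le> x ^ N * c * (1 / (1 - x))" by simp
    qed
    \<comment> \<open>The term at \<open>n = 0\<close> is 0 by division by zero, in accordance with
      \<open>b 0 = 0\<close>.\<close>
    have "(\<lambda>n. - (x ^ n) / real n) sums ln (1 - x)" using ln_series'[of "- x"] x by simp
    from sums_mult[OF this, of "- C"] have lns: "(\<lambda>n. C / real n * x ^ n) sums (C * - ln (1 - x))"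
      by simp
    have le: "b n * x ^ n \<le> C / real n * x ^ n" for n
      using mult_right_mono[OF C(2)[of n], of "x ^ n"] b(1) x by (cases "n = 0") simp_all
    have sb: "summable (\<lambda>n. b n * x ^ n)"
      using le b(2) x by (intro summable_comparison_test'[OF sums_summable[OF lns], of 0]) auto
    have up: "(\<Sum>n. b n * x ^ n) \<le> C * - ln (1 - x)"
      using sums_le[OF le summable_sums[OF sb] lns] .
    have "0 < b 1 * x ^ 1" using b x by simp
    also have "\<dots> \<le> (\<Sum>n. b n * x ^ n)"
      using sum_le_suminf[OF sb, of "{1}"] b x by simp
    finally have pos: "0 < (\<Sum>n. b n * x ^ n)" .
    show ?case unfolding h_def
    proof (rule frac_le[OF _ num])
      show "0 \<le> (\<Sum>n. diffs a n * x ^ n)"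
        using order_trans[OF _ num] c(1) x by simp
      show "0 < (\<Sum>n. b n * x ^ n) * (1 + (\<Sum>n. b n * x ^ n))" using pos by simp
      show "(\<Sum>n. b n * x ^ n) * (1 + (\<Sum>n. b n * x ^ n)) \<le> C * - ln (1 - x) * (1 + C * - ln (1 - x))"
        using up pos by (intro mult_mono) auto
    qed
  qed
  ultimately show ?thesis by (rule filterlim_at_top_mono)
qed

text \<open>With \<open>b\<close> summable, Abel's theorem gives the denominator a finite limit,
  positive because of \<open>b 1\<close>; the limit of the numerator may be infinite.\<close>

lemma powser_ratio_convergent:
  fixes a b :: "nat \<Rightarrow> real"
  assumes a: "\<And>n. 0 \<le> a n" "\<And>x. 0 \<le> x \<Longrightarrow> x < 1 \<Longrightarrow> summable (\<lambda>n. diffs a n * x ^ n)"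
    and b: "\<And>n. 0 \<le> b n" "b 1 > 0" "summable b"
  shows "\<exists>U. ((\<lambda>x. ennreal ((\<Sum>n. diffs a n * x ^ n) /
    ((\<Sum>n. b n * x ^ n) * (1 + (\<Sum>n. b n * x ^ n))))) \<longlongrightarrow> U) (at_left 1)"
proof (rule exI[where x = "(\<Sum>n. ennreal (diffs a n)) / ennreal ((\<Sum>n. b n) * (1 + (\<Sum>n. b n)))"],
    rule tendsto_ennreal_divide_real)
  have d: "diffs a n \<ge> 0" for n using a(1) by (simp add: diffs_def)
  show "((\<lambda>x. ennreal (\<Sum>n. diffs a n * x ^ n)) \<longlongrightarrow> (\<Sum>n. ennreal (diffs a n))) (at_left 1)"
    by (rule power_series_tendsto_at_left[OF d a(2)])
  show "((\<lambda>x. (\<Sum>n. b n * x ^ n) * (1 + (\<Sum>n. b n * x ^ n))) \<longlongrightarrow> (\<Sum>n. b n) * (1 + (\<Sum>n. b n))) (at_left 1)"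
    by (intro tendsto_intros powser_tendsto_suminf b)
  have "b 1 \<le> (\<Sum>n. b n)" using sum_le_suminf[OF b(3), of "{1}"] b by simp
  then have "(\<Sum>n. b n) > 0" using b by simp
  then show "0 < (\<Sum>n. b n) * (1 + (\<Sum>n. b n))" by simp
  show "\<forall>\<^sub>F x in at_left 1. 0 \<le> (\<Sum>n. diffs a n * x ^ n)"
    using d a by (intro eventually_at_left_1 suminf_nonneg) auto
qed

section \<open>The bounding series as power series\<close>

text \<open>One family covers the coefficients of both \<open>UB\<close> and \<open>LB\<close>. The
  value 0 at \<open>n = 0\<close> reflects that these series start at \<open>n = 1\<close>.\<close>

definition tail_coeff :: "(nat \<Rightarrow> real) \<Rightarrow> nat \<Rightarrow> real \<Rightarrow> real \<Rightarrow> real \<Rightarrow> nat \<Rightarrow> real" where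
  "tail_coeff r N c e T n =
     (if n = 0 then 0 else if n < N then r n else c * (real n powr e * T ^ n))"

lemma tail_coeff_nonneg:
  "0 \<le> c \<Longrightarrow> 0 \<le> T \<Longrightarrow> (\<And>n. 0 \<le> r n) \<Longrightarrow> 0 \<le> tail_coeff r N c e T n"
  by (simp add: tail_coeff_def)

text \<open>A factor \<open>n\<close> raises the exponent by 1, so the derivative series stay in the
  same family.\<close>

lemma tail_coeff_of_nat_mult:
  "real n * tail_coeff r N c e T n = tail_coeff (\<lambda>n. real n * r n) N c (e + 1) T n"
  by (simp add: tail_coeff_def powr_add)

lemma summable_powr_mult_power:
  fixes T :: real
  assumes "e \<le> 0" "0 \<le> T" "T < 1"
  shows "summable (\<lambda>n. real n powr e * T ^ n)"
proof (rule summable_comparison_test'[of "\<lambda>n. T ^ n" 1])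
  show "summable (\<lambda>n. T ^ n)" using assms by simp
  fix n :: nat assume "1 \<le> n"
  then have "real n powr e \<le> real n powr 0" using assms by (intro powr_mono) auto
  then show "norm (real n powr e * T ^ n) \<le> T ^ n"
    using assms \<open>1 \<le> n\<close> by (simp add: abs_mult mult_left_le_one_le)
qed

lemma tail_coeff_sums:
  assumes e: "e \<le> 0" and T: "0 \<le> T" "T \<le> 1" and x: "0 \<le> x" "x < 1" and N: "N \<ge> 1"
  shows "(\<lambda>n. tail_coeff r N c e T n * x ^ n) sums
    ((\<Sum>n\<in>{1..<N}. r n * x ^ n) + c * (\<Sum>m. real (m + N) powr e * (T * x) ^ (m + N)))"
proof -
  have Tx: "0 \<le> T * x" "T * x < 1" using T x by (auto intro: mult_le_one le_less_trans[OF mult_left_le_one_le])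
  have "summable (\<lambda>m. real (m + N) powr e * (T * x) ^ (m + N))"
    using summable_powr_mult_power[OF e Tx] by (rule summable_ignore_initial_segment)
  then have "(\<lambda>m. c * (real (m + N) powr e * (T * x) ^ (m + N))) sums
      (c * (\<Sum>m. real (m + N) powr e * (T * x) ^ (m + N)))"
    by (intro sums_mult summable_sums)
  moreover have "c * (real (m + N) powr e * (T * x) ^ (m + N)) = tail_coeff r N c e T (m + N) * x ^ (m + N)" for m
    using N by (simp add: tail_coeff_def power_mult_distrib)
  ultimately have "(\<lambda>m. tail_coeff r N c e T (m + N) * x ^ (m + N)) sums
      (c * (\<Sum>m. real (m + N) powr e * (T * x) ^ (m + N)))" by simp
  then have "(\<lambda>n. tail_coeff r N c e T n * x ^ n) sums
      (c * (\<Sum>m. real (m + N) powr e * (T * x) ^ (m + N)) + (\<Sum>n<N. tail_coeff r N c e T n * x ^ n))"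
    by (subst (asm) sums_iff_shift) simp
  moreover have "(\<Sum>n<N. tail_coeff r N c e T n * x ^ n) = (\<Sum>n\<in>{1..<N}. r n * x ^ n)"
    by (rule sum.mono_neutral_cong_right) (auto simp: tail_coeff_def)
  ultimately show ?thesis by (simp add: add.commute)
qed

text \<open>The previous summation formula is applied with exponent \<open>e + 1\<close>; then the
  vanishing term at 0 is dropped and the series divided by \<open>x\<close>.\<close>

lemma tail_coeff_diffs_sums:
  assumes e: "e + 1 \<le> 0" and T: "0 \<le> T" "T \<le> 1" and x: "0 < x" "x < 1" and N: "N \<ge> 1"
  shows "(\<lambda>n. diffs (tail_coeff r N c e T) n * x ^ n) sums
    ((\<Sum>n\<in>{1..<N}. real n * r n * x ^ (n - 1)) + c * (\<Sum>m. real (m + N) powr (e + 1) * (T * x) ^ (m + N) / x))"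
proof -
  have Tx: "0 \<le> T * x" "T * x < 1" using T x by (auto intro: mult_le_one le_less_trans[OF mult_left_le_one_le])
  have "(\<lambda>n. real n * tail_coeff r N c e T n * x ^ n) sums
      ((\<Sum>n\<in>{1..<N}. real n * r n * x ^ n) + c * (\<Sum>m. real (m + N) powr (e + 1) * (T * x) ^ (m + N)))"
    unfolding tail_coeff_of_nat_mult using assms by (intro tail_coeff_sums) auto
  then have "(\<lambda>n. real (Suc n) * tail_coeff r N c e T (Suc n) * x ^ Suc n) sums
      ((\<Sum>n\<in>{1..<N}. real n * r n * x ^ n) + c * (\<Sum>m. real (m + N) powr (e + 1) * (T * x) ^ (m + N)))"
    by (subst sums_Suc_iff) simp
  from sums_divide[OF this, of x] have "(\<lambda>n. diffs (tail_coeff r N c e T) n * x ^ n) sums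
      ((\<Sum>n\<in>{1..<N}. real n * r n * x ^ n) / x + c * ((\<Sum>m. real (m + N) powr (e + 1) * (T * x) ^ (m + N)) / x))"
    using x by (simp add: diffs_def add_divide_distrib mult.assoc)
  moreover have "(\<Sum>n\<in>{1..<N}. real n * r n * x ^ n) / x = (\<Sum>n\<in>{1..<N}. real n * r n * x ^ (n - 1))"
    unfolding sum_divide_distrib using x by (intro sum.cong) (auto simp: power_eq_if)
  moreover have "(\<Sum>m. real (m + N) powr (e + 1) * (T * x) ^ (m + N)) / x =
      (\<Sum>m. real (m + N) powr (e + 1) * (T * x) ^ (m + N) / x)"
    using summable_powr_mult_power[OF e Tx] by (intro suminf_divide[symmetric] summable_ignore_initial_segment)
  ultimately show ?thesis by (simp only:)
qed

text \<open>The denominator series is summable at 1 if \<open>T < 1\<close>, by comparison with a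
  geometric series, and if \<open>d \<ge> 4\<close>, where its exponent is at most -3/2. In the
  remaining case \<open>d = 3\<close>, \<open>T = 1\<close> the tails are harmonic.\<close>

lemma tail_ratio_limit_exists:
  assumes r: "\<And>n. 0 \<le> r n" "\<And>n. r n \<le> 1" "0 < r 1" and d: "d \<ge> 3" and T: "0 < T" "T \<le> 1"
    and N: "N \<ge> 1" "L \<ge> 1" and c: "0 < c" "0 < k"
  defines "a \<equiv> tail_coeff r N c (- (real d - 1) / 2) T"
    and "b \<equiv> tail_coeff r L k (- (real d - 1) / 2) T"
  shows "\<exists>U. ((\<lambda>x. ennreal ((\<Sum>n. diffs a n * x ^ n) /
    ((\<Sum>n. b n * x ^ n) * (1 + (\<Sum>n. b n * x ^ n))))) \<longlongrightarrow> U) (at_left 1)"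
proof -
  let ?e = "- (real d - 1) / 2"
  have e: "?e + 1 \<le> 0" using d by (simp add: field_simps)
  have nn: "0 \<le> a n" "0 \<le> b n" for n
    using r c T by (auto simp: a_def b_def intro!: tail_coeff_nonneg)
  have b1: "0 < b 1" using r(3) c T by (auto simp: b_def tail_coeff_def)
  have da: "summable (\<lambda>n. diffs a n * x ^ n)" if "0 < x" "x < 1" for x
    unfolding a_def using T N that by (intro sums_summable[OF tail_coeff_diffs_sums[OF e]]) auto
  show ?thesis
  proof (cases "d = 3 \<and> T = 1")
    case False
    have "summable (\<lambda>n. real n powr ?e * T ^ n)"
    proof (cases "T < 1")
      case True
      then show ?thesis using T d by (intro summable_powr_mult_power) auto
    next
      case T1: False
      with False T d have "T = 1" "d \<ge> 4" by auto
      then show ?thesis by (simp add: summable_real_powr_iff)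
    qed
    then have "summable (\<lambda>n. k * (real n powr ?e * T ^ n))" by (rule summable_mult)
    moreover have "\<forall>\<^sub>F n in sequentially. b n = k * (real n powr ?e * T ^ n)"
      using eventually_ge_at_top[of L]
      by eventually_elim (use N in \<open>auto simp: b_def tail_coeff_def\<close>)
    ultimately have "summable b" by (simp add: summable_cong)
    moreover have "summable (\<lambda>n. diffs a n * x ^ n)" if "0 \<le> x" "x < 1" for x
      using da that by (cases "x = 0") auto
    ultimately show ?thesis using nn b1 by (intro powser_ratio_convergent) auto
  next
    case True
    then have p: "real n powr ?e * T ^ n = 1 / real n" for n
      by (cases "n = 0") (auto simp: powr_minus_divide)
    \<comment> \<open>Below \<open>L\<close> the coefficient is at most 1, hence at most
      \<open>L / n\<close>; from \<open>L\<close> on it equals \<open>k / n\<close>. The constant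
      \<open>L + k\<close> covers both ranges.\<close>
    have "b n \<le> (real L + k) / real n" if "1 \<le> n" for n
    proof (cases "n < L")
      case True
      then have "b n \<le> 1" using that r by (simp add: b_def tail_coeff_def)
      also have "\<dots> \<le> (real L + k) / real n" using True that c by (simp add: field_simps)
      finally show ?thesis .
    next
      case False
      then show ?thesis unfolding b_def tail_coeff_def p using that by (simp add: divide_right_mono)
    qed
    moreover have "c / real n \<le> a n" if "N \<le> n" for n
      unfolding a_def tail_coeff_def p using that N by simp
    moreover have "b 0 = 0" by (simp add: b_def tail_coeff_def)
    ultimately have "LIM x at_left 1. (\<Sum>n. diffs a n * x ^ n) /
        ((\<Sum>n. b n * x ^ n) * (1 + (\<Sum>n. b n * x ^ n))) :> at_top"
      using nn da b1 c N by (intro powser_ratio_at_top[where c = c and C = "real L + k" and N = N]) auto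
    then show ?thesis unfolding ennreal_tendsto_top_eq_at_top[symmetric] by blast
  qed
qed

lemma le_tail_coeff:
  assumes "\<And>n. N \<le> n \<Longrightarrow> 1 \<le> n \<Longrightarrow> r n \<le> c * (real n powr e * T ^ n)"
  shows "(if n = 0 then 0 else r n) \<le> tail_coeff r N c e T n"
  using assms[of n] by (auto simp: tail_coeff_def)

lemma tail_coeff_le:
  assumes "\<And>n. N \<le> n \<Longrightarrow> 1 \<le> n \<Longrightarrow> c * (real n powr e * T ^ n) \<le> r n"
  shows "tail_coeff r N c e T n \<le> (if n = 0 then 0 else r n)"
  using assms[of n] by (auto simp: tail_coeff_def)

text \<open>The quotient grows with its numerator and falls with its denominator, so coefficientwise
  comparison suffices; \<open>b 1 > 0\<close> keeps the smaller denominator positive.\<close>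

lemma powser_ratio_mono:
  fixes a b a' b' :: "nat \<Rightarrow> real"
  assumes x: "0 < x"
    and a: "\<And>n. 0 \<le> a n" "\<And>n. a n \<le> a' n" "summable (\<lambda>n. diffs a n * x ^ n)" "summable (\<lambda>n. diffs a' n * x ^ n)"
    and b: "\<And>n. 0 \<le> b n" "\<And>n. b n \<le> b' n" "0 < b 1" "summable (\<lambda>n. b n * x ^ n)" "summable (\<lambda>n. b' n * x ^ n)"
  shows "(\<Sum>n. diffs a n * x ^ n) / ((\<Sum>n. b' n * x ^ n) * (1 + (\<Sum>n. b' n * x ^ n))) \<le>
    (\<Sum>n. diffs a' n * x ^ n) / ((\<Sum>n. b n * x ^ n) * (1 + (\<Sum>n. b n * x ^ n)))"
proof -
  have num: "(\<Sum>n. diffs a n * x ^ n) \<le> (\<Sum>n. diffs a' n * x ^ n)"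
    using a x by (intro suminf_le) (auto simp: diffs_def intro!: mult_mono)
  have num0: "0 \<le> (\<Sum>n. diffs a n * x ^ n)"
    using a x by (intro suminf_nonneg) (auto simp: diffs_def)
  have den: "(\<Sum>n. b n * x ^ n) \<le> (\<Sum>n. b' n * x ^ n)"
    using b x by (intro suminf_le) (auto intro!: mult_mono)
  have "0 < b 1 * x ^ 1" using b x by simp
  also have "\<dots> \<le> (\<Sum>n. b n * x ^ n)"
    using sum_le_suminf[OF b(4), of "{1}"] b x by simp
  finally have pos: "0 < (\<Sum>n. b n * x ^ n)" .
  show ?thesis
    using num num0 den pos by (intro frac_le mult_mono) auto
qed

lemma summable_bounded_powser:
  fixes c :: "nat \<Rightarrow> real"
  assumes "\<And>n. \<bar>c n\<bar> \<le> 1" "\<bar>x\<bar> < 1"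
  shows "summable (\<lambda>n. c n * x ^ n)"
proof (rule summable_comparison_test'[of "\<lambda>n. \<bar>x\<bar> ^ n" 0])
  show "summable (\<lambda>n. \<bar>x\<bar> ^ n)" using assms by simp
  show "norm (c n * x ^ n) \<le> \<bar>x\<bar> ^ n" for n
    using assms(1)[of n] by (simp add: abs_mult power_abs mult_left_le_one_le)
qed

lemma summable_abs_power_mult:
  fixes c :: "nat \<Rightarrow> real"
  assumes "\<And>n. 0 \<le> c n" "\<And>x. \<bar>x\<bar> < 1 \<Longrightarrow> summable (\<lambda>n. c n * x ^ n)" "\<bar>x\<bar> < 1"
  shows "summable (\<lambda>n. norm (c n * x ^ n))"
  using assms(2)[of "\<bar>x\<bar>"] assms(1,3) by (simp add: abs_mult power_abs)

section \<open>Generating functions of the walks and the final comparison\<close>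

context bernoulli_walks
begin

text \<open>Since \<open>rr d p 0\<close> is 1, omitting that term makes \<open>1 + \<phi>\<close>
  the full generating function of \<open>rr d p\<close>.\<close>

definition return_coeff :: "nat \<Rightarrow> real" where
  "return_coeff n = (if n = 0 then 0 else rr d p n)"

lemma return_coeff_bounds: "0 \<le> return_coeff n" "return_coeff n \<le> 1"
  using rr_nonneg rr_le_one by (auto simp: return_coeff_def)

lemma summable_return: "\<bar>x\<bar> < 1 \<Longrightarrow> summable (\<lambda>n. return_coeff n * x ^ n)"
  by (rule summable_bounded_powser) (auto simp: return_coeff_bounds)

lemma first_prob_le_one: "first_prob n \<le> 1"
  by (simp add: first_prob_def)

lemma summable_first: "\<bar>x\<bar> < 1 \<Longrightarrow> summable (\<lambda>n. first_prob n * x ^ n)"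
  by (rule summable_bounded_powser) (auto simp: first_prob_nonneg first_prob_le_one)

text \<open>The renewal equation is a convolution, so its right-hand side is the Cauchy product of
  the series of \<open>first_prob\<close> and of \<open>rr d p\<close>; both converge absolutely for
  \<open>\<bar>x\<bar> < 1\<close>.\<close>

lemma generating_function_renewal:
  assumes x: "\<bar>x\<bar> < 1"
  shows "(\<Sum>n. first_prob n * x ^ n) * (1 + (\<Sum>n. return_coeff n * x ^ n)) = (\<Sum>n. return_coeff n * x ^ n)"
proof -
  define R where "R = (\<Sum>n. return_coeff n * x ^ n)"
  have rr: "rr d p n * x ^ n = (if n = 0 then 1 else 0) + return_coeff n * x ^ n" for n
    by (simp add: return_coeff_def rr_zero)
  have "(\<lambda>n. if n = 0 then 1 else 0::real) sums 1" using sums_single[of 0 "\<lambda>_. 1::real"] by simp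
  then have "(\<lambda>n. rr d p n * x ^ n) sums (1 + R)"
    unfolding rr R_def by (intro sums_add summable_sums summable_return x)
  moreover have "summable (\<lambda>n. rr d p n * y ^ n)" if "\<bar>y\<bar> < 1" for y
    using that by (intro summable_bounded_powser) (auto simp: rr_nonneg rr_le_one)
  ultimately have "(\<lambda>n. \<Sum>i\<le>n. (first_prob i * x ^ i) * (rr d p (n - i) * x ^ (n - i))) sums
      ((\<Sum>n. first_prob n * x ^ n) * (1 + R))"
    using Cauchy_product_sums[OF summable_abs_power_mult[OF first_prob_nonneg summable_first x]
        summable_abs_power_mult[of "rr d p", OF rr_nonneg _ x]]
    by (simp add: sums_iff)
  moreover have "(\<Sum>i\<le>n. (first_prob i * x ^ i) * (rr d p (n - i) * x ^ (n - i))) = return_coeff n * x ^ n" for n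
  proof (cases "n = 0")
    case False
    have "(\<Sum>i\<le>n. (first_prob i * x ^ i) * (rr d p (n - i) * x ^ (n - i))) =
        (\<Sum>i\<le>n. first_prob i * rr d p (n - i) * x ^ n)"
      by (intro sum.cong) (auto simp: algebra_simps simp flip: power_add)
    also have "\<dots> = (\<Sum>i=1..n. first_prob i * rr d p (n - i) * x ^ n)"
      by (rule sum.mono_neutral_cong_right) (auto simp: first_prob_zero not_less_eq_eq)
    also have "\<dots> = return_coeff n * x ^ n"
      using False renewal_equation[of n] by (simp add: return_coeff_def sum_distrib_right)
    finally show ?thesis .
  qed (simp add: return_coeff_def first_prob_zero)
  ultimately have "(\<lambda>n. return_coeff n * x ^ n) sums ((\<Sum>n. first_prob n * x ^ n) * (1 + R))" by simp
  then show ?thesis by (simp add: sums_iff R_def)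
qed

lemma return_one_pos: "0 < return_coeff 1"
proof -
  have "QQ d p > 0" "PP d p > 0" unfolding QQ_def PP_def using p_bounds by (auto intro!: prod_pos)
  then show ?thesis by (simp add: return_coeff_def rr_def lessThan_Suc atMost_Suc add_pos_pos)
qed

lemma return_sum_pos:
  assumes "0 < x" "x < 1"
  shows "0 < (\<Sum>n. return_coeff n * x ^ n)"
proof -
  have "0 < return_coeff 1 * x ^ 1" using return_one_pos assms by simp
  also have "\<dots> \<le> (\<Sum>n. return_coeff n * x ^ n)"
    using sum_le_suminf[OF summable_return, of x "{1}"] return_coeff_bounds assms by simp
  finally show ?thesis .
qed

text \<open>Differentiating \<open>F * (1 + R) = R\<close> gives
  \<open>F' * (1 + R) = R' * (1 - F)\<close>, where \<open>1 - F = 1 / (1 + R)\<close>. It remains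
  to divide by \<open>F = R / (1 + R)\<close>.\<close>

lemma first_ratio_eq_return_ratio:
  assumes x: "0 < x" "x < 1"
  shows "(\<Sum>n. diffs first_prob n * x ^ n) / (\<Sum>n. first_prob n * x ^ n) =
    (\<Sum>n. diffs return_coeff n * x ^ n) /
      ((\<Sum>n. return_coeff n * x ^ n) * (1 + (\<Sum>n. return_coeff n * x ^ n)))"
proof -
  define F R where "F = (\<lambda>x. \<Sum>n. first_prob n * x ^ n)" and "R = (\<lambda>x. \<Sum>n. return_coeff n * x ^ n)"
  define F' R' where "F' = (\<Sum>n. diffs first_prob n * x ^ n)" and "R' = (\<Sum>n. diffs return_coeff n * x ^ n)"
  have dF: "(F has_real_derivative F') (at x)" unfolding F_def F'_def
    by (rule termdiffs_strong'[of 1]) (use summable_first x in auto)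
  have dR: "(R has_real_derivative R') (at x)" unfolding R_def R'_def
    by (rule termdiffs_strong'[of 1]) (use summable_return x in auto)
  have eq: "F y * (1 + R y) = R y" if "y \<in> {0<..<1}" for y
    using generating_function_renewal[of y] that by (simp add: F_def R_def)
  have "((\<lambda>y. F y * (1 + R y)) has_real_derivative F' * (1 + R x) + F x * R') (at x)"
    by (auto intro!: derivative_eq_intros dF dR)
  \<comment> \<open>The functional equation holds on an open interval around \<open>x\<close>, so
    both sides have the same derivative there.\<close>
  then have "(R has_real_derivative F' * (1 + R x) + F x * R') (at x)"
    by (rule has_field_derivative_transform_within_open[of _ _ _ "{0<..<1}"]) (use x eq in auto)
  then have 1: "F' * (1 + R x) + F x * R' = R'" using dR by (rule DERIV_unique)
  have Rpos: "0 < R x" using return_sum_pos[OF x] by (simp add: R_def)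
  have 2: "F x = R x / (1 + R x)" using eq[of x] x Rpos by (simp add: field_simps)
  have "F' * (1 + R x) = R' / (1 + R x)"
  proof -
    have "F' * (1 + R x) = R' * (1 - F x)" using 1 by (simp add: algebra_simps)
    also have "1 - F x = 1 / (1 + R x)" using Rpos unfolding 2 by (simp add: field_simps)
    finally show ?thesis by simp
  qed
  then have "F' / F x = R' / (1 + R x) / R x" unfolding 2 by simp
  then have "F' / F x = R' / (R x * (1 + R x))" by (simp add: mult.commute)
  then show ?thesis by (simp add: F_def R_def F'_def R'_def)
qed

text \<open>The quotient is replaced by \<open>F' / F\<close>. By Abel's theorem its parts tend to
  the sums of \<open>n * first_prob n\<close> and of \<open>first_prob n\<close>, whose quotient is
  the conditional expectation.\<close>

lemma return_ratio_tendsto: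
  "((\<lambda>x. ennreal ((\<Sum>n. diffs return_coeff n * x ^ n) /
      ((\<Sum>n. return_coeff n * x ^ n) * (1 + (\<Sum>n. return_coeff n * x ^ n)))))
    \<longlongrightarrow> cond_exp_finite M (rencontre_time d X)) (at_left 1)"
proof -
  have d: "diffs first_prob n \<ge> 0" for n by (simp add: diffs_def first_prob_nonneg)
  have s: "summable (\<lambda>n. diffs first_prob n * x ^ n)" if "0 \<le> x" "x < 1" for x
    using that by (intro termdiff_converges[of x 1] summable_first) auto
  \<comment> \<open>At \<open>n = 1\<close> the renewal sum has a single term; this shows that a
    rencontre occurs with positive probability.\<close>
  have "first_prob 1 = return_coeff 1"
    using renewal_equation[of 1] by (simp add: rr_zero return_coeff_def)
  then have "0 < first_prob 1" using return_one_pos by simp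
  also have "first_prob 1 \<le> (\<Sum>n. first_prob n)"
    using sum_le_suminf[OF first_prob_summable, of "{1}"] first_prob_nonneg by simp
  finally have pos: "0 < (\<Sum>n. first_prob n)" .
  have "((\<lambda>x. ennreal ((\<Sum>n. diffs first_prob n * x ^ n) / (\<Sum>n. first_prob n * x ^ n)))
      \<longlongrightarrow> (\<Sum>n. ennreal (diffs first_prob n)) / ennreal (\<Sum>n. first_prob n)) (at_left 1)"
  proof (rule tendsto_ennreal_divide_real)
    show "((\<lambda>x. ennreal (\<Sum>n. diffs first_prob n * x ^ n)) \<longlongrightarrow> (\<Sum>n. ennreal (diffs first_prob n))) (at_left 1)"
      by (rule power_series_tendsto_at_left[OF d s])
    show "((\<lambda>x. \<Sum>n. first_prob n * x ^ n) \<longlongrightarrow> (\<Sum>n. first_prob n)) (at_left 1)"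
      by (rule powser_tendsto_suminf[OF first_prob_nonneg first_prob_summable])
    show "\<forall>\<^sub>F x in at_left 1. 0 \<le> (\<Sum>n. diffs first_prob n * x ^ n)"
      using d s by (intro eventually_at_left_1 suminf_nonneg) auto
  qed (rule pos)
  also have "(\<Sum>n. ennreal (diffs first_prob n)) / ennreal (\<Sum>n. first_prob n) =
      cond_exp_finite M (rencontre_time d X)"
    by (simp add: cond_exp_finite_rencontre_time suminf_ennreal_diffs
        suminf_ennreal2[OF first_prob_nonneg first_prob_summable])
  finally show ?thesis
  proof (rule Lim_transform_eventually)
    show "\<forall>\<^sub>F x in at_left 1. ennreal ((\<Sum>n. diffs first_prob n * x ^ n) / (\<Sum>n. first_prob n * x ^ n)) =
        ennreal ((\<Sum>n. diffs return_coeff n * x ^ n) /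
          ((\<Sum>n. return_coeff n * x ^ n) * (1 + (\<Sum>n. return_coeff n * x ^ n))))"
      by (rule eventually_at_left_1) (simp only: first_ratio_eq_return_ratio)
  qed
qed

text \<open>The coefficients satisfy \<open>l n \<le> return_coeff n \<le> u n\<close>. This
  encloses the quotient for every \<open>x\<close> in (0, 1), and the inequalities survive the
  passage to the limit.\<close>

lemma rencontre_bounds:
  assumes d3: "d \<ge> 3" and l1: "0 < lam1" "lam1 < 1" and l2: "0 < lam2" "lam2 < 1"
  shows "\<exists>U. ((\<lambda>x. ennreal (UB' d p lam1 x / (LB d p lam2 x * (1 + LB d p lam2 x)))) \<longlongrightarrow> U) (at_left 1)
      \<and> cond_exp_finite M (rencontre_time d X) \<le> U"
    and "\<exists>V. ((\<lambda>x. ennreal (LB' d p lam2 x / (UB d p lam1 x * (1 + UB d p lam1 x)))) \<longlongrightarrow> V) (at_left 1)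
      \<and> V \<le> cond_exp_finite M (rencontre_time d X)"
proof -
  define \<alpha> T e where "\<alpha> = PP d p powr (1 / real d)" and "T = TT d p" and "e = - (real d - 1) / 2"
  define N L where "N = NN \<alpha> lam1" and "L = LL \<alpha> lam2"
  define c k where "c = (MM \<alpha> lam1 / sqrt (2 * pi)) ^ (d - 1)" and "k = (sqrt (2 * pi) / exp 2) ^ d * KK \<alpha> d lam2"
  define u l where "u = tail_coeff (rr d p) N c e T" and "l = tail_coeff (rr d p) L k e T"
  have P: "PP d p > 0" and Q: "QQ d p > 0"
    unfolding QQ_def PP_def using p_bounds by (auto intro!: prod_pos)
  then have \<alpha>: "\<alpha> > 0" by (simp add: \<alpha>_def)
  have T: "0 < T" "T \<le> 1"
    using Q \<alpha> TT_le_one[of d p] d_pos p_bounds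
    by (simp_all add: T_def TT_def add_pos_pos flip: \<alpha>_def)
  have N: "N \<ge> 1" "L \<ge> 1" by (auto simp: N_def L_def NN_def LL_def Let_def)
  have c: "0 < c" "0 < k"
    using \<alpha> l1 KK_bounds(1)[OF \<alpha> l2] by (auto simp: c_def k_def MM_def)
  \<comment> \<open>The derivative series carry the exponent \<open>e + 1\<close>, which is
    nonpositive because \<open>d \<ge> 3\<close>.\<close>
  have e: "e + 1 \<le> 0" "e \<le> 0" and e1: "- (real d - 3) / 2 = e + 1" using d3 by (auto simp: e_def field_simps)
  have UB: "(\<lambda>n. u n * x ^ n) sums UB d p lam1 x"
    and UB': "(\<lambda>n. diffs u n * x ^ n) sums UB' d p lam1 x"
    and LB: "(\<lambda>n. l n * x ^ n) sums LB d p lam2 x"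
    and LB': "(\<lambda>n. diffs l n * x ^ n) sums LB' d p lam2 x"
    if "0 < x" "x < 1" for x
    unfolding UB_def UB'_def LB_def LB'_def Let_def e1 \<alpha>_def[symmetric] T_def[symmetric] e_def[symmetric]
      N_def[symmetric] L_def[symmetric] c_def[symmetric] k_def[symmetric] u_def l_def
    using e T N that by (intro tail_coeff_sums tail_coeff_diffs_sums; simp)+
  have ru: "return_coeff n \<le> u n" for n
    unfolding return_coeff_def u_def c_def e_def T_def N_def \<alpha>_def
    using T l1 by (intro le_tail_coeff rr_le P d_pos) (auto simp: T_def)
  have lr: "l n \<le> return_coeff n" for n
    unfolding return_coeff_def l_def k_def e_def T_def L_def \<alpha>_def
    using T l2 by (intro tail_coeff_le rr_ge P d_pos) (auto simp: T_def)
  have l0: "0 \<le> l n" for n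
    unfolding l_def using c T by (intro tail_coeff_nonneg rr_nonneg) auto
  have rr1: "0 < rr d p 1" using return_one_pos by (simp add: return_coeff_def)
  have l1pos: "0 < l 1" using rr1 c T by (auto simp: l_def tail_coeff_def)
  have sr: "summable (\<lambda>n. return_coeff n * x ^ n)" "summable (\<lambda>n. diffs return_coeff n * x ^ n)"
    if "0 < x" "x < 1" for x
    using that summable_return[of x] by (auto intro!: termdiff_converges[of x 1] summable_return)
  have upper: "(\<Sum>n. diffs return_coeff n * x ^ n) /
        ((\<Sum>n. return_coeff n * x ^ n) * (1 + (\<Sum>n. return_coeff n * x ^ n)))
      \<le> UB' d p lam1 x / (LB d p lam2 x * (1 + LB d p lam2 x))"
    and lower: "LB' d p lam2 x / (UB d p lam1 x * (1 + UB d p lam1 x)) \<le>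
      (\<Sum>n. diffs return_coeff n * x ^ n) /
        ((\<Sum>n. return_coeff n * x ^ n) * (1 + (\<Sum>n. return_coeff n * x ^ n)))"
    if x: "0 < x" "x < 1" for x
    \<comment> \<open>Each bound pairs the derivative of one enclosing series with the other series
      in the denominator.\<close>
    using powser_ratio_mono[of x return_coeff u l return_coeff] powser_ratio_mono[of x l return_coeff return_coeff u]
      x ru lr l0 l1pos return_one_pos return_coeff_bounds sr[OF x]
      UB[OF x] UB'[OF x] LB[OF x] LB'[OF x]
    by (auto simp: sums_iff)
  have ratios: "\<forall>\<^sub>F x in at_left 1. ennreal ((\<Sum>n. diffs u n * x ^ n) /
        ((\<Sum>n. l n * x ^ n) * (1 + (\<Sum>n. l n * x ^ n)))) =
      ennreal (UB' d p lam1 x / (LB d p lam2 x * (1 + LB d p lam2 x)))"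
    "\<forall>\<^sub>F x in at_left 1. ennreal ((\<Sum>n. diffs l n * x ^ n) /
        ((\<Sum>n. u n * x ^ n) * (1 + (\<Sum>n. u n * x ^ n)))) =
      ennreal (LB' d p lam2 x / (UB d p lam1 x * (1 + UB d p lam1 x)))"
    using UB UB' LB LB' by (auto intro!: eventually_at_left_1 simp: sums_iff)
  obtain U where U: "((\<lambda>x. ennreal (UB' d p lam1 x / (LB d p lam2 x * (1 + LB d p lam2 x)))) \<longlongrightarrow> U) (at_left 1)"
    using tail_ratio_limit_exists[where r = "rr d p", OF rr_nonneg rr_le_one rr1 d3 T N c] Lim_transform_eventually[OF _ ratios(1)]
    unfolding u_def l_def e_def by blast
  obtain V where V: "((\<lambda>x. ennreal (LB' d p lam2 x / (UB d p lam1 x * (1 + UB d p lam1 x)))) \<longlongrightarrow> V) (at_left 1)"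
    using tail_ratio_limit_exists[where r = "rr d p", OF rr_nonneg rr_le_one rr1 d3 T N(2,1) c(2,1)] Lim_transform_eventually[OF _ ratios(2)]
    unfolding u_def l_def e_def by blast
  have nb: "at_left (1::real) \<noteq> bot" by simp
  have "cond_exp_finite M (rencontre_time d X) \<le> U"
    by (rule tendsto_le[OF nb U return_ratio_tendsto])
      (intro eventually_at_left_1 ennreal_leI upper)
  moreover have "V \<le> cond_exp_finite M (rencontre_time d X)"
    by (rule tendsto_le[OF nb return_ratio_tendsto V])
      (intro eventually_at_left_1 ennreal_leI lower)
  ultimately show "\<exists>U. ((\<lambda>x. ennreal (UB' d p lam1 x / (LB d p lam2 x * (1 + LB d p lam2 x)))) \<longlongrightarrow> U) (at_left 1)
      \<and> cond_exp_finite M (rencontre_time d X) \<le> U"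
    and "\<exists>V. ((\<lambda>x. ennreal (LB' d p lam2 x / (UB d p lam1 x * (1 + UB d p lam1 x)))) \<longlongrightarrow> V) (at_left 1)
      \<and> V \<le> cond_exp_finite M (rencontre_time d X)"
    using U V by blast+
qed

end

text \<open>The limits live in \<open>ennreal\<close> because the expectation and the upper bound
  may be infinite. Limits there are unique, so each existential statement speaks of the limit
  itself.\<close>

theorem theorem16:
  fixes M :: "'a measure" and X :: "nat \<Rightarrow> nat \<Rightarrow> 'a \<Rightarrow> bool"
    and d :: nat and p :: "nat \<Rightarrow> real" and lam1 lam2 :: real
  assumes "prob_space M"
    and "d \<ge> 3"
    and "\<And>j. j < d \<Longrightarrow> 0 < p j \<and> p j < 1"
    and "prob_space.indep_vars M (\<lambda>_. count_space UNIV) (\<lambda>(j, k). X j k) ({..<d} \<times> {1..})"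
    and "\<And>j k. j < d \<Longrightarrow> k \<ge> 1 \<Longrightarrow> measure M {\<omega> \<in> space M. X j k \<omega>} = p j"
    and "0 < lam1" "lam1 < 1" "0 < lam2" "lam2 < 1"
  shows "(\<exists>U. ((\<lambda>x. ennreal (UB' d p lam1 x / (LB d p lam2 x * (1 + LB d p lam2 x))))
                \<longlongrightarrow> U) (at_left 1)
            \<and> cond_exp_finite M (rencontre_time d X) \<le> U)
         \<and> (\<exists>V. ((\<lambda>x. ennreal (LB' d p lam2 x / (UB d p lam1 x * (1 + UB d p lam1 x))))
                \<longlongrightarrow> V) (at_left 1)
            \<and> V \<le> cond_exp_finite M (rencontre_time d X))"
proof -
  interpret bernoulli_walks M X d p
    using assms by (intro bernoulli_walks.intro bernoulli_walks_axioms.intro) auto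
  show ?thesis
    using rencontre_bounds[OF assms(2,6-9)] by blast
qed

end
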